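(* For every positive integer $n$ and every odd positive integer $m=2k+1$, $$N(SO(2n),m)=\binom{n+[m/2]-1}{[m/2]}+2\binom{n+[m/2]-1}{[m/2]-1}=\binom{n+[m/2]-1}{[m/2]}\frac{n+m-1}{n}.$$
   Context: $SO(N)$ is the group of real $N\times N$ orthogonal matrices of determinant $1$. $N(G,m)$ denotes the number of conjugacy classes of $G$ (under conjugation by elements of $G$, here $SO(2n)$) contained in $\{x\in G: x^m=1\}$. $[\cdot]$ denotes the integer part (floor). *)

theory Defs
  imports
    "Jordan_Normal_Form.Determinant"
    "HOL-Algebra.Group_Action"
begin

definition SO :: "nat \<Rightarrow> real mat monoid" where
  "SO N = \<lparr>
    carrier = {A \<in> carrier_mat N N. transpose_mat A * A = 1\<^sub>m N \<and> det A = 1},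
    mult = (*),
    one = 1\<^sub>m N \<rparr>"

lemma group_SO: "group (SO N)"
proof (rule groupI)
  fix A assume "A \<in> carrier (SO N)"
  then have A: "A \<in> carrier_mat N N" "transpose_mat A * A = 1\<^sub>m N" "det A = 1"
    by (auto simp: SO_def)
  then have "A * transpose_mat A = 1\<^sub>m N"
    using mat_mult_left_right_inverse[of "transpose_mat A" N A] by auto
  with A show "\<exists>B\<in>carrier (SO N). B \<otimes>\<^bsub>SO N\<^esub> A = \<one>\<^bsub>SO N\<^esub>"
    by (intro bexI[of _ "transpose_mat A"]) (auto simp: SO_def det_transpose)
next
  fix A B assume "A \<in> carrier (SO N)" "B \<in> carrier (SO N)"
  then have A: "A \<in> carrier_mat N N" "transpose_mat A * A = 1\<^sub>m N" "det A = 1"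
    and B: "B \<in> carrier_mat N N" "transpose_mat B * B = 1\<^sub>m N" "det B = 1"
    by (auto simp: SO_def)
  have "transpose_mat (A * B) * (A * B) = transpose_mat B * ((transpose_mat A * A) * B)"
    using A(1) B(1) by (simp add: transpose_mult[of A N N B N] assoc_mult_mat[of _ N N _ N _ N])
  also have "\<dots> = 1\<^sub>m N"
    using A B by simp
  finally show "A \<otimes>\<^bsub>SO N\<^esub> B \<in> carrier (SO N)"
    using A B by (simp add: SO_def det_mult[of A N B])
qed (auto simp: SO_def assoc_mult_mat[of _ N N _ N _ N])

definition conj_classes :: "('a, 'b) monoid_scheme \<Rightarrow> 'a set set" where
  "conj_classes G = orbits G (carrier G) (\<lambda>g. \<lambda>x\<in>carrier G. g \<otimes>\<^bsub>G\<^esub> x \<otimes>\<^bsub>G\<^esub> inv\<^bsub>G\<^esub> g)"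

definition num_conj_classes :: "('a, 'b) monoid_scheme \<Rightarrow> nat \<Rightarrow> nat" where
  "num_conj_classes G m =
    card {C \<in> conj_classes G. C \<subseteq> {x \<in> carrier G. x [^]\<^bsub>G\<^esub> m = \<one>\<^bsub>G\<^esub>}}"

text \<open>
  Binomial coefficient with an integer lower index, zero when that index is negative. This is
  needed because truncated subtraction on \<^typ>\<open>nat\<close> would turn the lower index
  \<open>k - 1\<close> into \<open>0\<close> at \<open>k = 0\<close>, giving \<open>1\<close> instead of \<open>0\<close>.
\<close>

definition binom :: "nat \<Rightarrow> int \<Rightarrow> nat" where
  "binom a j = (if j < 0 then 0 else a choose nat j)"

end

theory Submission
  imports Defs "Jordan_Normal_Form.Char_Poly"
begin

text \<open>
  An element \<open>A\<close> of \<open>SO(2 n)\<close> with \<open>A\<^sup>m = 1\<close>, \<open>m = 2 k + 1\<close>, is orthogonally conjugate to a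
  sum of plane rotations by the angles \<open>2 \<pi> j\<^sub>i / m\<close> with \<open>0 \<le> j\<^sub>i \<le> k\<close>; since \<open>m\<close> is odd, \<open>- 1\<close> is not
  an eigenvalue. The cosines of the angles are the eigenvalues of \<open>(A + A\<^sup>T) / 2\<close>, so the multiset of
  the \<open>j\<^sub>i\<close> is determined by the class of \<open>A\<close>. Under \<open>SO(2 n)\<close> the orthogonal class of a normal form
  splits in two exactly if no \<open>j\<^sub>i\<close> vanishes: if some \<open>j\<^sub>i\<close> vanishes, a reflection of the plane
  fixed by that rotation commutes with the normal form; otherwise every matrix commuting with the
  normal form and its transpose is complex linear for the complex structure rotating all planes by
  a right angle, and so has nonnegative determinant. This leaves a count of multisets of size \<open>n\<close>
  in \<open>{0, \<dots>, k}\<close> and in \<open>{1, \<dots>, k}\<close>.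
\<close>

section \<open>Sums of plane rotations\<close>

text \<open>Coordinates \<open>i\<close> and \<open>n + i\<close> span the i-th plane. With this
  layout all four blocks are diagonal, and products of such matrices reduce to addition formulas for
  the angles.\<close>

definition rot :: "nat \<Rightarrow> (nat \<Rightarrow> real) \<Rightarrow> real mat" where
  "rot n \<theta> = four_block_mat (mat_diag n (\<lambda>i. cos (\<theta> i))) (mat_diag n (\<lambda>i. - sin (\<theta> i)))
                            (mat_diag n (\<lambda>i. sin (\<theta> i))) (mat_diag n (\<lambda>i. cos (\<theta> i)))"

lemma rot_carrier [simp]: "rot n \<theta> \<in> carrier_mat (2 * n) (2 * n)"
  unfolding rot_def mult_2 by (rule four_block_carrier_mat) auto

lemma dim_rot [simp]: "dim_row (rot n \<theta>) = 2 * n" "dim_col (rot n \<theta>) = 2 * n"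
  using carrier_matD[OF rot_carrier] by blast+

lemma rot_cong:
  assumes "\<And>i. i < n \<Longrightarrow> cos (\<theta> i) = cos (\<phi> i)" "\<And>i. i < n \<Longrightarrow> sin (\<theta> i) = sin (\<phi> i)"
  shows "rot n \<theta> = rot n \<phi>"
  unfolding rot_def by (intro cong_four_block_mat eq_matI) (auto simp: mat_diag_def assms)

lemma mat_diag_add:
  fixes f g :: "nat \<Rightarrow> 'a :: monoid_add"
  shows "mat_diag n f + mat_diag n g = mat_diag n (\<lambda>i. f i + g i)"
  by (rule eq_matI) (auto simp: mat_diag_def)

lemma transpose_mat_diag [simp]: "transpose_mat (mat_diag n f) = mat_diag n f"
  by (rule eq_matI) (auto simp: mat_diag_def)

lemma rot_mult: "rot n \<theta> * rot n \<phi> = rot n (\<lambda>i. \<theta> i + \<phi> i)"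
  unfolding rot_def
  by (subst mult_four_block_mat[of _ n n _ n _ n _ _ n _ n])
     (auto simp: mat_diag_add cos_add sin_add intro!: cong_four_block_mat arg_cong[of _ _ "mat_diag n"])

lemma rot_zero: "rot n (\<lambda>_. 0) = 1\<^sub>m (2 * n)"
proof -
  have "mat_diag n (\<lambda>_. 0) = (0\<^sub>m n n :: real mat)"
    by (rule eq_matI) (auto simp: mat_diag_def)
  then show ?thesis by (simp add: rot_def mult_2)
qed

lemma rot_transpose: "transpose_mat (rot n \<theta>) = rot n (\<lambda>i. - \<theta> i)"
  unfolding rot_def by (subst transpose_four_block_mat[of _ n n _ n _ n]) auto

lemma rot_pow: "rot n \<theta> ^\<^sub>m t = rot n (\<lambda>i. real t * \<theta> i)"
  by (induction t) (auto simp: rot_zero rot_mult algebra_simps)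

lemma rot_orthogonal: "transpose_mat (rot n \<theta>) * rot n \<theta> = 1\<^sub>m (2 * n)"
  by (simp add: rot_transpose rot_mult rot_zero)

lemma det_pow_mat:
  assumes "A \<in> carrier_mat N N"
  shows "det (A ^\<^sub>m t) = det A ^ t"
proof (induction t)
  case (Suc t)
  have "det (A ^\<^sub>m t * A) = det (A ^\<^sub>m t) * det A"
    using assms by (intro det_mult[of _ N]) auto
  then show ?case using Suc by simp
qed (use assms in simp)

text \<open>The determinant is a real m-th root of unity, hence 1 for odd \<open>m\<close>. This
  puts the normal forms into \<open>SO\<close> without computing their determinants.\<close>

lemma det_eq_1_of_odd_pow:
  fixes A :: "real mat"
  assumes "A \<in> carrier_mat N N" "A ^\<^sub>m m = 1\<^sub>m N" "odd m"
  shows "det A = 1"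
proof -
  have "det A ^ m = 1"
    using det_pow_mat[OF assms(1), of m] assms(2) by simp
  then have "det A ^ m = 1 ^ m" by simp
  then show ?thesis
    using odd_real_root_unique[OF assms(3)] by metis
qed

section \<open>A reflection in the first plane\<close>

definition reflection :: "nat \<Rightarrow> real mat" where
  "reflection n = four_block_mat (1\<^sub>m n) (0\<^sub>m n n) (0\<^sub>m n n) (mat_diag n (\<lambda>i. if i = 0 then - 1 else 1))"

lemma reflection_carrier [simp]: "reflection n \<in> carrier_mat (2 * n) (2 * n)"
  unfolding reflection_def mult_2 by (rule four_block_carrier_mat) auto

lemma dim_reflection [simp]: "dim_row (reflection n) = 2 * n" "dim_col (reflection n) = 2 * n"
  using carrier_matD[OF reflection_carrier] by blast+

lemma det_reflection:
  assumes "n > 0" shows "det (reflection n) = - 1"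
proof -
  let ?D = "mat_diag n (\<lambda>i. if i = 0 then - 1 else 1 :: real)"
  have "det (reflection n) = det (1\<^sub>m n) * det ?D"
    unfolding reflection_def by (rule det_four_block_mat_lower_left_zero) auto
  also have "det ?D = prod_list (diag_mat ?D)"
    by (rule det_upper_triangular[of _ n]) (auto simp: mat_diag_def)
  also have "\<dots> = (\<Prod>i<n. if i = 0 then - 1 else 1)"
    unfolding prod_list_diag_prod by (rule prod.cong) (auto simp: mat_diag_def)
  also have "\<dots> = - 1"
    using assms by (subst prod.delta) auto
  finally show ?thesis by simp
qed

lemma reflection_transpose: "transpose_mat (reflection n) = reflection n"
  unfolding reflection_def by (subst transpose_four_block_mat[of _ n n _ n _ n]) auto

lemma reflection_square: "reflection n * reflection n = 1\<^sub>m (2 * n)"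
proof -
  have "(\<lambda>i. (if i = 0 then - 1 else 1) * (if i = 0 then - 1 else (1::real))) = (\<lambda>_::nat. 1)"
    by auto
  then show ?thesis
    unfolding reflection_def
    by (subst mult_four_block_mat[of _ n n _ n _ n _ _ n _ n]) (auto simp: mult_2 left_mult_zero_mat[of _ n n] right_mult_zero_mat[of _ n n])
qed

text \<open>Reflecting a plane reverses its rotation, and the other planes are untouched. This
  relates the two \<open>SO\<close> classes into which an orthogonal class may split.\<close>

lemma reflection_rot:
  "reflection n * rot n \<theta> * reflection n = rot n (\<theta>(0 := - \<theta> 0))"
proof -
  \<comment> \<open>Written as diagonal matrices, the zero and identity blocks fall under the
    product rules for \<open>mat_diag\<close>; \<open>mat_diag_one\<close> would undo this and is
    disabled below.\<close>
  have z: "0\<^sub>m n n = mat_diag n (\<lambda>_. 0 :: real)" "1\<^sub>m n = mat_diag n (\<lambda>_. 1 :: real)"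
    by (auto simp: mat_diag_def)
  show ?thesis
    unfolding reflection_def rot_def z
    by (subst mult_four_block_mat[of _ n n _ n _ n _ _ n _ n], simp_all del: mat_diag_one)
       (subst mult_four_block_mat[of _ n n _ n _ n _ _ n _ n],
        auto simp: mat_diag_add simp del: mat_diag_one intro!: cong_four_block_mat arg_cong[of _ _ "mat_diag n"])
qed

text \<open>This is the real form of the complex matrix \<open>Z = X + i Y\<close>. Over the complex
  numbers it is similar to a block triangular matrix with diagonal blocks \<open>Z\<close> and its
  conjugate, so its determinant is the squared modulus of \<open>det Z\<close>.\<close>

lemma det_complex_structure_nonneg:
  fixes X Y :: "real mat"
  assumes X: "X \<in> carrier_mat n n" and Y: "Y \<in> carrier_mat n n"
  shows "det (four_block_mat X (- Y) Y X) \<ge> 0"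
proof -
  interpret r: comm_ring_hom complex_of_real by unfold_locales auto
  interpret c: comm_ring_hom cnj by unfold_locales auto
  let ?X = "map_mat complex_of_real X" and ?Y = "map_mat complex_of_real Y"
  define Z where "Z = ?X + \<i> \<cdot>\<^sub>m ?Y"
  have Z: "Z \<in> carrier_mat n n" using X Y by (simp add: Z_def)
  let ?M = "four_block_mat ?X (- ?Y) ?Y ?X"
  \<comment> \<open>\<open>?L\<close> and \<open>?R\<close> are inverse to each other: one adds i
    times the first block row to the second, the other subtracts i times the second block column
    from the first.\<close>
  let ?L = "four_block_mat (1\<^sub>m n) (0\<^sub>m n n) (\<i> \<cdot>\<^sub>m 1\<^sub>m n) (1\<^sub>m n)"
  let ?R = "four_block_mat (1\<^sub>m n) (0\<^sub>m n n) (- \<i> \<cdot>\<^sub>m 1\<^sub>m n) (1\<^sub>m n)"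
  have M: "?M \<in> carrier_mat (n + n) (n + n)" using X Y by auto
  have L: "?L \<in> carrier_mat (n + n) (n + n)" "?R \<in> carrier_mat (n + n) (n + n)"
    by (rule four_block_carrier_mat; simp)+
  have "?L * ?M = four_block_mat ?X (- ?Y) (\<i> \<cdot>\<^sub>m ?X + ?Y) (- (\<i> \<cdot>\<^sub>m ?Y) + ?X)"
    using X Y
    by (subst mult_four_block_mat[of _ n n _ n _ n _ _ n _ n]) (auto simp: mult_smult_assoc_mat[of _ n n _ n])
  also have "\<dots> * ?R = four_block_mat Z (- ?Y) (0\<^sub>m n n) (map_mat cnj Z)"
    using X Y
    apply (subst mult_four_block_mat[of _ n n _ n _ n _ _ n _ n]; (simp; fail)?)
    apply (rule cong_four_block_mat; rule eq_matI)
    apply (auto simp: Z_def algebra_simps)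
    done
  finally have "det (?L * ?M * ?R) = det Z * det (map_mat cnj Z)"
    using X Y Z by (simp add: det_four_block_mat_lower_left_zero[of _ n _ n])
  also have "det (?L * ?M * ?R) = det ?L * det ?M * det ?R"
    using M L by (metis det_mult mult_carrier_mat)
  also have "det ?L = 1" by (subst det_four_block_mat_upper_right_zero[of _ n _ n]) auto
  also have "det ?R = 1" by (subst det_four_block_mat_upper_right_zero[of _ n _ n]) auto
  also have "?M = map_mat complex_of_real (four_block_mat X (- Y) Y X)"
    using X Y by (subst map_four_block_mat[of _ n n _ n _ n]) (auto intro!: cong_four_block_mat)
  finally have "complex_of_real (det (four_block_mat X (- Y) Y X)) = det Z * cnj (det Z)"
    by simp
  also have "\<dots> = complex_of_real ((cmod (det Z))\<^sup>2)"
    by (rule complex_norm_square[symmetric])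
  finally show ?thesis
    by (metis of_real_eq_iff zero_le_power2)
qed

text \<open>The transpose of \<open>D\<close> is its inverse, and whatever commutes with
  \<open>D\<close> commutes with its inverse.\<close>

lemma commute_transpose:
  fixes P D :: "'a :: field mat"
  assumes "P \<in> carrier_mat N N" "D \<in> carrier_mat N N" "transpose_mat D * D = 1\<^sub>m N"
    and PD: "P * D = D * P"
  shows "P * transpose_mat D = transpose_mat D * P"
proof -
  have T: "transpose_mat D \<in> carrier_mat N N" using assms by simp
  have inv: "D * transpose_mat D = 1\<^sub>m N"
    using assms T mat_mult_left_right_inverse by blast
  have "P * transpose_mat D = transpose_mat D * D * (P * transpose_mat D)"
    using assms by simp
  also have "\<dots> = transpose_mat D * (P * D) * transpose_mat D"
    unfolding PD using assms(1,2) T by (simp add: assoc_mult_mat[of _ N N _ N _ N])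
  also have "\<dots> = transpose_mat D * P * (D * transpose_mat D)"
    using assms(1,2) T by (simp add: assoc_mult_mat[of _ N N _ N _ N])
  finally show ?thesis using assms by (simp add: inv)
qed

text \<open>Commuting with the rotation and with its transpose separates the sine part from the
  cosine part. Positive sines then force \<open>P\<close> to be complex linear for the quarter turn
  of all planes, that is, to have the blocks X, -Y, Y, X.\<close>

lemma det_commute_rot_nonneg:
  assumes P: "P \<in> carrier_mat (2 * n) (2 * n)" and comm: "P * rot n \<theta> = rot n \<theta> * P"
    and pos: "\<And>i. i < n \<Longrightarrow> sin (\<theta> i) > 0"
  shows "det P \<ge> 0"
proof -
  obtain X Z Y W where split: "split_block P n n = (X, Z, Y, W)"
    by (metis surj_pair)
  note sb = split_block[OF split, of n n]
  have X: "X \<in> carrier_mat n n" and Z: "Z \<in> carrier_mat n n"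
    and Y: "Y \<in> carrier_mat n n" and W: "W \<in> carrier_mat n n"
    and P_eq: "P = four_block_mat X Z Y W"
    using sb P by auto
  let ?c = "\<lambda>i. cos (\<theta> i)" and ?s = "\<lambda>i. sin (\<theta> i)"
  have comm': "P * rot n (\<lambda>i. - \<theta> i) = rot n (\<lambda>i. - \<theta> i) * P"
    using commute_transpose[OF P rot_carrier rot_orthogonal comm] by (simp add: rot_transpose)
  have entries: "X $$ (i,j) * cos (\<phi> j) + Z $$ (i,j) * sin (\<phi> j) = cos (\<phi> i) * X $$ (i,j) - sin (\<phi> i) * Y $$ (i,j)"
     "- X $$ (i,j) * sin (\<phi> j) + Z $$ (i,j) * cos (\<phi> j) = cos (\<phi> i) * Z $$ (i,j) - sin (\<phi> i) * W $$ (i,j)"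
     "Y $$ (i,j) * cos (\<phi> j) + W $$ (i,j) * sin (\<phi> j) = sin (\<phi> i) * X $$ (i,j) + cos (\<phi> i) * Y $$ (i,j)"
     "- Y $$ (i,j) * sin (\<phi> j) + W $$ (i,j) * cos (\<phi> j) = sin (\<phi> i) * Z $$ (i,j) + cos (\<phi> i) * W $$ (i,j)"
    if "i < n" "j < n" and "P * rot n \<phi> = rot n \<phi> * P" for \<phi> i j
  proof -
    have l: "P * rot n \<phi> = four_block_mat 
       (X * mat_diag n (\<lambda>i. cos (\<phi> i)) + Z * mat_diag n (\<lambda>i. sin (\<phi> i)))
       (X * mat_diag n (\<lambda>i. - sin (\<phi> i)) + Z * mat_diag n (\<lambda>i. cos (\<phi> i)))
       (Y * mat_diag n (\<lambda>i. cos (\<phi> i)) + W * mat_diag n (\<lambda>i. sin (\<phi> i)))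
       (Y * mat_diag n (\<lambda>i. - sin (\<phi> i)) + W * mat_diag n (\<lambda>i. cos (\<phi> i)))"
      unfolding P_eq rot_def using X Y Z W
      by (subst mult_four_block_mat[of _ n n _ n _ n _ _ n _ n]) auto
    have r: "rot n \<phi> * P = four_block_mat 
       (mat_diag n (\<lambda>i. cos (\<phi> i)) * X + mat_diag n (\<lambda>i. - sin (\<phi> i)) * Y)
       (mat_diag n (\<lambda>i. cos (\<phi> i)) * Z + mat_diag n (\<lambda>i. - sin (\<phi> i)) * W)
       (mat_diag n (\<lambda>i. sin (\<phi> i)) * X + mat_diag n (\<lambda>i. cos (\<phi> i)) * Y)
       (mat_diag n (\<lambda>i. sin (\<phi> i)) * Z + mat_diag n (\<lambda>i. cos (\<phi> i)) * W)"
      unfolding P_eq rot_def using X Y Z W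
      by (subst mult_four_block_mat[of _ n n _ n _ n _ _ n _ n]) auto
    note eq = arg_cong[OF that(3)[unfolded l r], of "\<lambda>M. M $$ (i,j)"]
      arg_cong[OF that(3)[unfolded l r], of "\<lambda>M. M $$ (i,j+n)"]
      arg_cong[OF that(3)[unfolded l r], of "\<lambda>M. M $$ (i+n,j)"]
      arg_cong[OF that(3)[unfolded l r], of "\<lambda>M. M $$ (i+n,j+n)"]
    note eqs = eq[unfolded mat_diag_mult_left[OF X] mat_diag_mult_left[OF Y] mat_diag_mult_left[OF Z] 
       mat_diag_mult_left[OF W] mat_diag_mult_right[OF X] mat_diag_mult_right[OF Y] mat_diag_mult_right[OF Z] 
       mat_diag_mult_right[OF W]]
    show "X $$ (i,j) * cos (\<phi> j) + Z $$ (i,j) * sin (\<phi> j) = cos (\<phi> i) * X $$ (i,j) - sin (\<phi> i) * Y $$ (i,j)"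
     "- X $$ (i,j) * sin (\<phi> j) + Z $$ (i,j) * cos (\<phi> j) = cos (\<phi> i) * Z $$ (i,j) - sin (\<phi> i) * W $$ (i,j)"
     "Y $$ (i,j) * cos (\<phi> j) + W $$ (i,j) * sin (\<phi> j) = sin (\<phi> i) * X $$ (i,j) + cos (\<phi> i) * Y $$ (i,j)"
     "- Y $$ (i,j) * sin (\<phi> j) + W $$ (i,j) * cos (\<phi> j) = sin (\<phi> i) * Z $$ (i,j) + cos (\<phi> i) * W $$ (i,j)"
      using eqs that(1,2) X Y Z W by simp_all
  qed
  have XW: "X $$ (i,j) = W $$ (i,j)" and ZY: "Z $$ (i,j) = - Y $$ (i,j)" if ij: "i < n" "j < n" for i j
  proof -
    \<comment> \<open>Comparing the equations for \<theta> and for its negative cancels the cosine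
      terms.\<close>
    have e: "X $$ (i,j) * ?s j = ?s i * W $$ (i,j)" "W $$ (i,j) * ?s j = ?s i * X $$ (i,j)"
      "Z $$ (i,j) * ?s j = - ?s i * Y $$ (i,j)" "Y $$ (i,j) * ?s j = - ?s i * Z $$ (i,j)"
      using entries[OF ij comm] entries[OF ij comm'] by simp_all
    have *: "a = b" if h: "a * ?s j = ?s i * b" "b * ?s j = ?s i * a" for a b :: real
    proof -
      have "(a - b) * (?s i + ?s j) = 0" using h by (simp add: algebra_simps)
      moreover have "?s i + ?s j > 0" using pos ij by (simp add: add_pos_pos)
      ultimately show "a = b" by simp
    qed
    show "X $$ (i,j) = W $$ (i,j)" using *[of "X $$ (i,j)" "W $$ (i,j)"] e by simp
    show "Z $$ (i,j) = - Y $$ (i,j)" using *[of "Z $$ (i,j)" "- Y $$ (i,j)"] e by simp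
  qed
  have "W = X" "Z = - Y"
    using XW ZY X Y Z W by (auto intro!: eq_matI)
  then show ?thesis
    using det_complex_structure_nonneg[OF X Y] P_eq by simp
qed

section \<open>The cosines as conjugation invariants\<close>

lemma prod_list_linear_factors_inj:
  fixes xs ys :: "'a :: idom list"
  assumes "(\<Prod>a\<leftarrow>xs. [:- a, 1:]) = (\<Prod>a\<leftarrow>ys. [:- a, 1:])"
  shows "mset xs = mset ys"
proof -
  have "proots (\<Prod>a\<leftarrow>zs. [:- a, 1:]) = mset zs" for zs :: "'a list"
  proof (induction zs)
    case (Cons z zs)
    have "(\<Prod>a\<leftarrow>zs. [:- a, 1:]) \<noteq> 0" by (auto simp: prod_list_zero_iff)
    then have "proots (\<Prod>a\<leftarrow>z # zs. [:- a, 1:]) = proots [:- z, 1:] + proots (\<Prod>a\<leftarrow>zs. [:- a, 1:])"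
      unfolding list.map prod_list.Cons by (intro proots_mult) auto
    with Cons show ?case by simp
  qed simp
  with assms show ?thesis by metis
qed

lemma double_mset_inj:
  fixes M M' :: "'a multiset"
  assumes "M + M = M' + M'" shows "M = M'"
proof (rule multiset_eqI)
  fix a
  have "count (M + M) a = count (M' + M') a" using assms by simp
  then show "count M a = count M' a" by simp
qed

lemma rot_add_transpose:
  "rot n \<theta> + transpose_mat (rot n \<theta>) =
     four_block_mat (mat_diag n (\<lambda>i. 2 * cos (\<theta> i))) (0\<^sub>m n n) (0\<^sub>m n n) (mat_diag n (\<lambda>i. 2 * cos (\<theta> i)))"
  unfolding rot_transpose unfolding rot_def
  by (subst add_four_block_mat[of _ n n _ n _ n]) 
     (auto simp: mat_diag_add intro!: cong_four_block_mat, (auto simp: mat_diag_def intro!: eq_matI))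

text \<open>An orthogonal conjugation also carries the transposes into each other, hence the
  symmetric sums \<open>F\<close>. These are diagonal, so equal characteristic polynomials mean
  equal multisets of diagonal entries.\<close>

lemma rot_conj_cos:
  assumes P: "P \<in> carrier_mat (2 * n) (2 * n)" "transpose_mat P * P = 1\<^sub>m (2 * n)"
    and eq: "P * rot n \<theta> * transpose_mat P = rot n \<phi>"
  shows "mset (map (\<lambda>i. cos (\<theta> i)) [0..<n]) = mset (map (\<lambda>i. cos (\<phi> i)) [0..<n])"
proof -
  let ?N = "2 * n" and ?T = "transpose_mat P"
  define F where "F \<theta> = rot n \<theta> + transpose_mat (rot n \<theta>)" for \<theta>
  have F: "F \<theta> \<in> carrier_mat ?N ?N" for \<theta> by (simp add: F_def)
  have T: "?T \<in> carrier_mat ?N ?N" using P by simp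
  have PT: "P * ?T = 1\<^sub>m ?N" using P T mat_mult_left_right_inverse by blast
  have "transpose_mat (rot n \<phi>) = P * transpose_mat (P * rot n \<theta>)"
    unfolding eq[symmetric] using P T by (subst transpose_mult[of _ ?N ?N _ ?N]) auto
  also have "\<dots> = P * (transpose_mat (rot n \<theta>) * ?T)"
    using P by (subst transpose_mult[of _ ?N ?N _ ?N]) auto
  also have "\<dots> = P * transpose_mat (rot n \<theta>) * ?T"
    using P T by (subst assoc_mult_mat[of _ ?N ?N _ ?N _ ?N]) auto
  finally have "transpose_mat (rot n \<phi>) = P * transpose_mat (rot n \<theta>) * ?T" .
  then have "F \<phi> = P * F \<theta> * ?T"
    unfolding F_def using P T
    by (simp add: eq[symmetric] mult_add_distrib_mat[of _ ?N ?N _ ?N] add_mult_distrib_mat[of _ ?N ?N _ _ ?N])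
  then have "similar_mat (F \<phi>) (F \<theta>)"
    by (intro similar_matI[of _ _ P ?T ?N]) (use P T PT F in auto)
  then have cp: "char_poly (F \<phi>) = char_poly (F \<theta>)" by (rule char_poly_similar)
  have dm: "diag_mat (F \<theta>) = map (\<lambda>i. 2 * cos (\<theta> i)) [0..<n] @ map (\<lambda>i. 2 * cos (\<theta> i)) [0..<n]" for \<theta>
    unfolding F_def rot_add_transpose
    by (subst diag_four_block_mat[of _ n _ n]) (auto simp: diag_mat_def mat_diag_def)
  have ut: "upper_triangular (F \<theta>)" for \<theta>
    unfolding F_def rot_add_transpose
    by (rule upper_triangular_four_block[of _ n _ n]) (auto simp: mat_diag_def)
  have "mset (diag_mat (F \<phi>)) = mset (diag_mat (F \<theta>))"
    using cp unfolding char_poly_upper_triangular[OF F ut] by (rule prod_list_linear_factors_inj)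
  \<comment> \<open>Each cosine sits on the diagonal once per block, so the multisets are halved
    before the factor 2 is removed.\<close>
  then have "mset (map (\<lambda>i. 2 * cos (\<phi> i)) [0..<n]) = mset (map (\<lambda>i. 2 * cos (\<theta> i)) [0..<n])"
    unfolding dm mset_append by (rule double_mset_inj)
  then have "image_mset (\<lambda>x. x / 2) (mset (map (\<lambda>i. 2 * cos (\<phi> i)) [0..<n])) = image_mset (\<lambda>x. x / 2) (mset (map (\<lambda>i. 2 * cos (\<theta> i)) [0..<n]))"
    by simp
  then show ?thesis
    by (simp add: image_mset.compositionality comp_def flip: mset_map)
qed

section \<open>Orthogonal matrices of odd finite order\<close>

text \<open>Take the vectors of \<open>U\<close> as rows of a square matrix, padded with zero rows.
  As \<open>card U < N\<close>, the last row is zero, so the matrix is singular; the vector is taken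
  from its kernel.\<close>

lemma exists_orthogonal_vec:
  fixes U :: "'a :: field vec set"
  assumes "finite U" "card U < N" "U \<subseteq> carrier_vec N"
  shows "\<exists>w\<in>carrier_vec N. w \<noteq> 0\<^sub>v N \<and> (\<forall>x\<in>U. x \<bullet> w = 0)"
proof -
  obtain l where l: "set l = U" "length l = card U"
    using assms(1) distinct_card finite_distinct_list by metis
  define M where "M = mat N N (\<lambda>(i,j). if i < length l then l ! i $ j else 0)"
  have M: "M \<in> carrier_mat N N" "transpose_mat M \<in> carrier_mat N N" by (auto simp: M_def)
  have "transpose_mat M *\<^sub>v unit_vec N (N - 1) = 0\<^sub>v N"
    using assms(2) M l by (intro eq_vecI) (auto simp: M_def)
  moreover have "unit_vec N (N - 1) \<noteq> (0\<^sub>v N :: 'a vec)"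
    using assms(2) by (auto simp: vec_eq_iff unit_vec_def intro!: exI[of _ "N - 1"])
  ultimately have "det (transpose_mat M) = 0"
    using det_0_iff_vec_prod_zero_field[OF M(2)] unit_vec_carrier by blast
  then obtain w where w: "w \<in> carrier_vec N" "w \<noteq> 0\<^sub>v N" "M *\<^sub>v w = 0\<^sub>v N"
    using det_0_iff_vec_prod_zero_field[OF M(1)] det_transpose[OF M(1)] by auto
  have "x \<bullet> w = 0" if x: "x \<in> U" for x
  proof -
    obtain i where i: "i < length l" "l ! i = x" using x l(1) by (metis in_set_conv_nth)
    then have "row M i = x" using assms l x by (intro eq_vecI) (auto simp: M_def)
    moreover have "(M *\<^sub>v w) $ i = row M i \<bullet> w" using i l assms(2) M by simp
    ultimately show ?thesis using w i l assms(2) by simp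
  qed
  with w show ?thesis by blast
qed

text \<open>Character orthogonality for the cyclic group of order \<open>m\<close>, in real form.
  For nonzero \<open>t\<close>, multiplication by \<open>2 * sin (\<alpha> / 2)\<close> makes the
  sum telescope to 0, and this factor is nonzero because \<alpha> / 2 lies strictly between 0 and
  pi.\<close>

lemma sum_cos_multiples:
  assumes "t < m"
  shows "(\<Sum>j<m. cos (2 * pi * real j * real t / real m)) = (if t = 0 then real m else 0)"
proof (cases "t = 0")
  case False
  define \<alpha> where "\<alpha> = 2 * pi * real t / real m"
  define f where "f j = sin (real j * \<alpha> - \<alpha> / 2)" for j :: nat
  have "f (Suc j) - f j = 2 * sin (\<alpha> / 2) * cos (real j * \<alpha>)" for j
  proof -
    have "real (Suc j) * \<alpha> - \<alpha> / 2 = real j * \<alpha> + \<alpha> / 2" by (simp add: algebra_simps)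
    then have "f (Suc j) = sin (real j * \<alpha> + \<alpha> / 2)" by (simp only: f_def)
    then show ?thesis unfolding f_def by (simp add: sin_add sin_diff)
  qed
  then have "2 * sin (\<alpha> / 2) * (\<Sum>j<m. cos (real j * \<alpha>)) = (\<Sum>j<m. f (Suc j) - f j)"
    by (simp add: sum_distrib_left)
  also have "\<dots> = f m - f 0" by (rule sum_lessThan_telescope)
  also have "\<dots> = 0"
  proof -
    have "real m * \<alpha> = 2 * real t * pi" using assms by (simp add: \<alpha>_def)
    then have "f m = sin (2 * real t * pi - \<alpha> / 2)" by (simp only: f_def)
    also have "\<dots> = - sin (\<alpha> / 2)" unfolding sin_diff sin_2npi cos_2npi by simp
    finally have "f m = - sin (\<alpha> / 2)" .
    then show ?thesis by (simp add: f_def)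
  qed
  finally have *: "sin (\<alpha> / 2) * (\<Sum>j<m. cos (real j * \<alpha>)) = 0" by simp
  have "0 < \<alpha> / 2" "\<alpha> / 2 < pi"
    using False assms by (auto simp: \<alpha>_def field_simps)
  then have "sin (\<alpha> / 2) > 0" by (rule sin_gt_zero)
  with * have "(\<Sum>j<m. cos (real j * \<alpha>)) = 0" by simp
  moreover have "real j * \<alpha> = 2 * pi * real j * real t / real m" for j
    by (simp add: \<alpha>_def)
  ultimately show ?thesis using False by simp
qed simp

lemma pow_mat_vec:
  assumes "A \<in> carrier_mat N N" "x \<in> carrier_vec N"
  shows "A ^\<^sub>m t *\<^sub>v x = ((*\<^sub>v) A ^^ t) x"
  using assms(2)
proof (induction t arbitrary: x)
  case (Suc t)
  have "A ^\<^sub>m Suc t *\<^sub>v x = A ^\<^sub>m t *\<^sub>v (A *\<^sub>v x)"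
    using assms(1) Suc.prems by (simp add: assoc_mult_mat_vec[of _ N N _ N])
  also have "\<dots> = ((*\<^sub>v) A ^^ Suc t) x"
    using Suc.IH[of "A *\<^sub>v x"] Suc.prems assms(1) by (simp add: funpow_swap1)
  finally show ?case .
qed (use assms in simp)

lemma sum_shift_periodic:
  fixes h :: "nat \<Rightarrow> 'a :: cancel_comm_monoid_add"
  assumes "h m = h 0"
  shows "(\<Sum>t<m. h (Suc t)) = (\<Sum>t<m. h t)"
  using sum.lessThan_Suc_shift[of h m] sum.lessThan_Suc[of h m] assms
  by (simp add: add.commute)

text \<open>
  The vector is obtained by projecting \<^term>\<open>w\<close> to an isotypic component of the
  cyclic group generated by \<^term>\<open>A\<close>, that is, as \<open>\<Sum>t<m. cos (2 \<pi> j t / m) A\<^sup>t w\<close>;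
  these projections sum up to \<open>m w\<close>, so one of them is nonzero.
\<close>

lemma exists_isotypic_vec:
  fixes A :: "real mat"
  assumes A: "A \<in> carrier_mat N N" and ord: "A ^\<^sub>m m = 1\<^sub>m N" and m: "m > 0"
    and w: "w \<in> carrier_vec N" "w \<noteq> 0\<^sub>v N"
  shows "\<exists>j\<le>m div 2. \<exists>z\<in>carrier_vec N. z \<noteq> 0\<^sub>v N \<and>
           A *\<^sub>v (A *\<^sub>v z) + z = (2 * cos (2 * pi * real j / real m)) \<cdot>\<^sub>v (A *\<^sub>v z) \<and>
           (\<forall>x\<in>carrier_vec N. (\<forall>t. x \<bullet> ((*\<^sub>v) A ^^ t) w = 0) \<longrightarrow> x \<bullet> z = 0)"
proof -
  define y where "y t = ((*\<^sub>v) A ^^ t) w" for t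
  have y0: "y 0 = w" and yS: "y (Suc t) = A *\<^sub>v y t" for t by (simp_all add: y_def)
  have y: "y t \<in> carrier_vec N" for t
    by (induction t) (use w A in \<open>auto simp: y0 yS\<close>)
  have ym: "y (t + m) = y t" for t
    using pow_mat_vec[OF A w(1), of m] ord w by (simp add: y_def funpow_add)
  define a where "a j t = cos (2 * pi * real j * real t / real m)" for j t :: nat
  have am: "a j (t + m) = a j t" for j t
  proof -
    have "2 * pi * real j * real (t + m) / real m = 2 * pi * real j * real t / real m + 2 * real j * pi"
      using m by (simp add: field_simps)
    then show ?thesis
      unfolding a_def by (simp only: cos_add sin_2npi cos_2npi)
  qed
  \<comment> \<open>The three-term recurrence of the cosine in \<open>t\<close>; summation turns it
    into the quadratic relation for \<open>A\<close> on \<open>z j\<close>.\<close>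
  have a_rec: "a j (t + 2) + a j t = 2 * cos (2 * pi * real j / real m) * a j (t + 1)" for j t
  proof -
    define \<beta> where "\<beta> = 2 * pi * real j / real m"
    have a: "a j s = cos (\<beta> * real s)" for s by (simp add: a_def \<beta>_def)
    have \<beta>: "\<beta> * real (t + 2) = \<beta> * real (t + 1) + \<beta>" "\<beta> * real t = \<beta> * real (t + 1) - \<beta>"
      by (simp_all add: algebra_simps)
    have "cos (\<beta> * real (t + 2)) + cos (\<beta> * real t) = 2 * cos \<beta> * cos (\<beta> * real (t + 1))"
      unfolding \<beta> cos_add cos_diff by simp
    then show ?thesis unfolding a \<beta>_def .
  qed
  define z where "z j = vec N (\<lambda>i. \<Sum>t<m. a j t * y t $ i)" for j
  have z: "z j \<in> carrier_vec N" for j by (simp add: z_def)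
  have dot: "x \<bullet> z j = (\<Sum>t<m. a j t * (x \<bullet> y t))" if "x \<in> carrier_vec N" for x j
  proof -
    have "x \<bullet> z j = (\<Sum>i<N. \<Sum>t<m. x $ i * (a j t * y t $ i))"
      by (simp add: scalar_prod_def z_def sum_distrib_left lessThan_atLeast0)
    also have "\<dots> = (\<Sum>t<m. \<Sum>i<N. x $ i * (a j t * y t $ i))" by (rule sum.swap)
    also have "\<dots> = (\<Sum>t<m. a j t * (x \<bullet> y t))"
      using carrier_vecD[OF y] by (auto simp: scalar_prod_def sum_distrib_left lessThan_atLeast0 mult.left_commute intro!: sum.cong)
    finally show ?thesis .
  qed
  have Az: "(A *\<^sub>v z j) = vec N (\<lambda>i. \<Sum>t<m. a j t * y (Suc t) $ i)" for j
    using A by (intro eq_vecI) (auto simp: dot yS row_carrier_vec)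
  have AAz: "(A *\<^sub>v (A *\<^sub>v z j)) = vec N (\<lambda>i. \<Sum>t<m. a j t * y (Suc (Suc t)) $ i)" for j
  proof (intro eq_vecI)
    fix i assume "i < dim_vec (vec N (\<lambda>i. \<Sum>t<m. a j t * y (Suc (Suc t)) $ i))"
    then have i: "i < N" by simp
    let ?x = "row (A * A) i"
    have x: "?x \<in> carrier_vec N" using A i by auto
    have row_y: "?x \<bullet> y t = y (Suc (Suc t)) $ i" for t
    proof -
      have "?x \<bullet> y t = (A * A *\<^sub>v y t) $ i" using A i by simp
      also have "A * A *\<^sub>v y t = y (Suc (Suc t))"
        using A y by (simp add: assoc_mult_mat_vec[of _ N N _ N] yS)
      finally show ?thesis .
    qed
    have "A *\<^sub>v (A *\<^sub>v z j) = A * A *\<^sub>v z j"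
      using A z by (simp add: assoc_mult_mat_vec[of _ N N _ N])
    then have "(A *\<^sub>v (A *\<^sub>v z j)) $ i = ?x \<bullet> z j"
      using A i by simp
    also have "\<dots> = (\<Sum>t<m. a j t * (?x \<bullet> y t))" by (rule dot[OF x])
    finally show "(A *\<^sub>v (A *\<^sub>v z j)) $ i = vec N (\<lambda>i. \<Sum>t<m. a j t * y (Suc (Suc t)) $ i) $ i"
      using i by (simp add: row_y)
  qed (use A in auto)
  have eq: "A *\<^sub>v (A *\<^sub>v z j) + z j = (2 * cos (2 * pi * real j / real m)) \<cdot>\<^sub>v (A *\<^sub>v z j)" for j
  proof -
    have "(\<Sum>t<m. a j t * y (Suc (Suc t)) $ i) + (\<Sum>t<m. a j t * y t $ i)
          = 2 * cos (2 * pi * real j / real m) * (\<Sum>t<m. a j t * y (Suc t) $ i)" for i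
    proof -
      \<comment> \<open>Cyclic shifts, allowed by periodicity in \<open>m\<close>, express all three
        sums through \<open>y (Suc (Suc t))\<close>; only the coefficients remain to be
        compared.\<close>
      have "(\<Sum>t<m. a j t * y t $ i) = (\<Sum>t<m. a j (Suc t) * y (Suc t) $ i)"
        using am[of j 0] ym[of 0] by (intro sum_shift_periodic[symmetric]) simp
      also have "\<dots> = (\<Sum>t<m. a j (Suc (Suc t)) * y (Suc (Suc t)) $ i)"
        using am[of j 1] ym[of 1] by (intro sum_shift_periodic[symmetric]) simp
      finally have 1: "(\<Sum>t<m. a j t * y t $ i) = \<dots>" .
      have 2: "(\<Sum>t<m. a j t * y (Suc t) $ i) = (\<Sum>t<m. a j (Suc t) * y (Suc (Suc t)) $ i)"
        using am[of j 0] ym[of 1] by (intro sum_shift_periodic[symmetric]) simp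
      show ?thesis
        unfolding 1 2 sum_distrib_left sum.distrib[symmetric]
      proof (rule sum.cong)
        fix t
        have "a j t * y (Suc (Suc t)) $ i + a j (Suc (Suc t)) * y (Suc (Suc t)) $ i =
              (a j (t + 2) + a j t) * y (Suc (Suc t)) $ i"
          by (simp add: algebra_simps)
        then show "a j t * y (Suc (Suc t)) $ i + a j (Suc (Suc t)) * y (Suc (Suc t)) $ i =
              2 * cos (2 * pi * real j / real m) * (a j (Suc t) * y (Suc (Suc t)) $ i)"
          unfolding a_rec by simp
      qed simp
    qed
    then show ?thesis unfolding AAz unfolding Az by (intro eq_vecI) (auto simp: z_def)
  qed
  have orth: "x \<bullet> z j = 0" if "x \<in> carrier_vec N" "\<forall>t. x \<bullet> ((*\<^sub>v) A ^^ t) w = 0" for x j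
    using that by (simp add: dot flip: y_def)
  have "\<exists>j<m. z j \<noteq> 0\<^sub>v N"
  proof (rule ccontr)
    assume "\<not> ?thesis"
    then have z0: "z j = 0\<^sub>v N" if "j < m" for j using that by blast
    have "w $ i = 0" if i: "i < N" for i
    proof -
      have "0 = (\<Sum>j<m. z j $ i)" using z0 i by simp
      also have "\<dots> = (\<Sum>j<m. \<Sum>t<m. a j t * y t $ i)" using i by (simp add: z_def)
      also have "\<dots> = (\<Sum>t<m. (\<Sum>j<m. a j t) * y t $ i)"
        by (subst sum.swap) (simp add: sum_distrib_right)
      also have "\<dots> = (\<Sum>t<m. if t = 0 then real m * w $ i else 0)"
        by (rule sum.cong) (auto simp: a_def sum_cos_multiples y0)
      also have "\<dots> = real m * w $ i" using m by (subst sum.delta) auto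
      finally show ?thesis using m by simp
    qed
    then have "w = 0\<^sub>v N" using w(1) by (intro eq_vecI) auto
    with w(2) show False by simp
  qed
  then obtain j where j: "j < m" "z j \<noteq> 0\<^sub>v N" by blast
  show ?thesis
  proof (cases "j \<le> m div 2")
    case True
    then show ?thesis using j z eq orth by blast
  next
    case False
    \<comment> \<open>The vector stays \<open>z j\<close> and only its index changes:
      \<open>j\<close> and \<open>m - j\<close> have the same cosine.\<close>
    have "2 * pi * real (m - j) / real m = 2 * pi - 2 * pi * real j / real m"
      using j m by (simp add: of_nat_diff field_simps)
    then have "cos (2 * pi * real (m - j) / real m) = cos (2 * pi * real j / real m)"
      by (simp add: cos_diff)
    moreover have "m - j \<le> m div 2" using False by linarith
    ultimately show ?thesis using j z eq[of j] orth by metis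
  qed
qed

section \<open>Rotation angles of odd order\<close>

definition angle :: "nat \<Rightarrow> nat \<Rightarrow> real" where
  "angle m j = 2 * pi * real j / real m"

text \<open>Oddness of \<open>m\<close> excludes \<open>2 * j = m\<close>, so the angle lies
  strictly between 0 and pi.\<close>

lemma sin_angle_pos:
  assumes "odd m" "0 < j" "j \<le> m div 2" shows "sin (angle m j) > 0"
proof (rule sin_gt_zero)
  have m: "m > 0" using assms(1) by (cases m) auto
  then show "0 < angle m j" using assms by (simp add: angle_def)
  have "2 * j < m" using assms by presburger
  then have "2 * real j < real m" by linarith
  then show "angle m j < pi" using m by (simp add: angle_def field_simps)
qed

text \<open>Since \<open>x\<close> is related to every entry in both directions, it fits at any
  position. Thus pairwise orthogonality survives sorting planes by angle index.\<close>

lemma sorted_wrt_insort_key: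
  assumes "sorted_wrt R xs" "\<forall>y\<in>set xs. R x y \<and> R y x"
  shows "sorted_wrt R (insort_key f x xs)"
  using assms by (induction xs) (auto simp: set_insort_key)

section \<open>Orthogonal invariant planes of an isometry of odd finite order\<close>

locale finite_order_isometry =
  fixes N m :: nat and A :: "real mat"
  assumes A: "A \<in> carrier_mat N N" and orth: "transpose_mat A * A = 1\<^sub>m N"
    and ord: "A ^\<^sub>m m = 1\<^sub>m N" and odd: "odd m"
begin

lemma A_vec [simp]: "x \<in> carrier_vec N \<Longrightarrow> A *\<^sub>v x \<in> carrier_vec N"
  using A by simp

lemma m_pos: "m > 0"
  using odd by (cases m) auto

lemma isometry:
  assumes "x \<in> carrier_vec N" "y \<in> carrier_vec N"
  shows "(A *\<^sub>v x) \<bullet> (A *\<^sub>v y) = x \<bullet> y"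
proof -
  have "(A *\<^sub>v x) \<bullet> (A *\<^sub>v y) = (transpose_mat A *\<^sub>v (A *\<^sub>v x)) \<bullet> y"
    using assms A by (subst transpose_vec_mult_scalar[OF A]) auto
  also have "transpose_mat A *\<^sub>v (A *\<^sub>v x) = x"
    using assms A orth by (simp flip: assoc_mult_mat_vec[of _ N N _ N])
  finally show ?thesis .
qed

text \<open>A set of vectors stands for its span. New vectors are sought in the orthogonal
  complement, and this condition keeps their orbits there.\<close>

definition complement_invariant :: "real vec set \<Rightarrow> bool" where
  "complement_invariant U \<longleftrightarrow> U \<subseteq> carrier_vec N \<and>
     (\<forall>w\<in>carrier_vec N. (\<forall>x\<in>U. x \<bullet> w = 0) \<longrightarrow> (\<forall>x\<in>U. x \<bullet> (A *\<^sub>v w) = 0))"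

text \<open>The triple records an angle index and an ordered orthonormal basis of the plane. For
  \<open>j = 0\<close> it amounts to two orthonormal fixed vectors.\<close>

fun rotation_plane :: "nat \<times> real vec \<times> real vec \<Rightarrow> bool" where
  "rotation_plane (j, u, v) \<longleftrightarrow> u \<in> carrier_vec N \<and> v \<in> carrier_vec N \<and>
     u \<bullet> u = 1 \<and> v \<bullet> v = 1 \<and> u \<bullet> v = 0 \<and>
     A *\<^sub>v u = cos (angle m j) \<cdot>\<^sub>v u + sin (angle m j) \<cdot>\<^sub>v v \<and>
     A *\<^sub>v v = (- sin (angle m j)) \<cdot>\<^sub>v u + cos (angle m j) \<cdot>\<^sub>v v"

text \<open>A nonzero vector orthogonal to \<open>U\<close> exists for reasons of dimension. Its
  orbit stays orthogonal to \<open>U\<close>, hence so does the isotypic vector obtained from the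
  orbit, which is then normalised.\<close>

lemma exists_unit_isotypic_vec:
  assumes U: "complement_invariant U" "finite U" "card U < N"
  obtains j u where "j \<le> m div 2" "u \<in> carrier_vec N" "u \<bullet> u = 1" "\<forall>x\<in>U. x \<bullet> u = 0"
    "A *\<^sub>v (A *\<^sub>v u) + u = (2 * cos (angle m j)) \<cdot>\<^sub>v (A *\<^sub>v u)"
proof -
  obtain w where w: "w \<in> carrier_vec N" "w \<noteq> 0\<^sub>v N" "\<forall>x\<in>U. x \<bullet> w = 0"
    using exists_orthogonal_vec[of U N] U by (auto simp: complement_invariant_def)
  have orbit: "((*\<^sub>v) A ^^ t) w \<in> carrier_vec N \<and> (\<forall>x\<in>U. x \<bullet> ((*\<^sub>v) A ^^ t) w = 0)" for t
    by (induction t) (use w U in \<open>auto simp: complement_invariant_def\<close>)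
  obtain j z where j: "j \<le> m div 2" and z: "z \<in> carrier_vec N" "z \<noteq> 0\<^sub>v N"
    and eq: "A *\<^sub>v (A *\<^sub>v z) + z = (2 * cos (angle m j)) \<cdot>\<^sub>v (A *\<^sub>v z)"
    and zU: "\<forall>x\<in>carrier_vec N. (\<forall>t. x \<bullet> ((*\<^sub>v) A ^^ t) w = 0) \<longrightarrow> x \<bullet> z = 0"
    using exists_isotypic_vec[OF A ord m_pos w(1,2)] unfolding angle_def by blast
  have zU: "\<forall>x\<in>U. x \<bullet> z = 0"
    using zU orbit U(1) by (auto simp: complement_invariant_def)
  have "z \<bullet> z > 0"
  proof -
    obtain i where i: "i < N" "z $ i \<noteq> 0" using z by (metis eq_vecI carrier_vecD index_zero_vec)
    have "0 < (\<Sum>i\<in>{0..<N}. z $ i * z $ i)" using i by (intro sum_pos2[of _ i]) (auto simp: zero_less_mult_iff)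
    then show ?thesis using z(1) by (simp add: scalar_prod_def)
  qed
  define r where "r = 1 / sqrt (z \<bullet> z)"
  have r: "r * (r * (z \<bullet> z)) = 1"
    using \<open>z \<bullet> z > 0\<close> by (simp add: r_def field_simps)
  show ?thesis
  proof (rule that[OF j])
    show "r \<cdot>\<^sub>v z \<in> carrier_vec N" using z by simp
    show "(r \<cdot>\<^sub>v z) \<bullet> (r \<cdot>\<^sub>v z) = 1" using z r by simp
    show "\<forall>x\<in>U. x \<bullet> (r \<cdot>\<^sub>v z) = 0"
      using zU z U(1) by (auto simp: complement_invariant_def scalar_prod_smult_distrib[of _ N])
    have "A *\<^sub>v (A *\<^sub>v (r \<cdot>\<^sub>v z)) + r \<cdot>\<^sub>v z = r \<cdot>\<^sub>v (A *\<^sub>v (A *\<^sub>v z) + z)"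
      using z A by (simp add: mult_mat_vec[OF A] smult_add_distrib_vec[of _ N])
    then show "A *\<^sub>v (A *\<^sub>v (r \<cdot>\<^sub>v z)) + r \<cdot>\<^sub>v z = (2 * cos (angle m j)) \<cdot>\<^sub>v (A *\<^sub>v (r \<cdot>\<^sub>v z))"
      unfolding eq using z A by (simp add: mult_mat_vec[OF A] smult_smult_assoc mult.commute)
  qed
qed

text \<open>Pair the relation with \<open>A *\<^sub>v u\<close>: by isometry both terms on the left
  equal the wanted inner product, and the right side is \<open>2 * c\<close>.\<close>

lemma isotypic_inner:
  assumes u: "u \<in> carrier_vec N" "u \<bullet> u = 1"
    and eq: "A *\<^sub>v (A *\<^sub>v u) + u = (2 * c) \<cdot>\<^sub>v (A *\<^sub>v u)"
  shows "u \<bullet> (A *\<^sub>v u) = c"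
proof -
  let ?p = "A *\<^sub>v u"
  have p: "?p \<in> carrier_vec N" using u by simp
  have "?p \<bullet> (A *\<^sub>v ?p + u) = ?p \<bullet> ((2 * c) \<cdot>\<^sub>v ?p)" by (simp add: eq)
  then have "?p \<bullet> (A *\<^sub>v ?p) + ?p \<bullet> u = 2 * c * (?p \<bullet> ?p)"
    using u p by (simp add: scalar_prod_add_distrib[of _ N] scalar_prod_smult_distrib[of _ N])
  then show ?thesis
    using u p isometry[of u ?p] isometry[of u u] comm_scalar_prod[of u N ?p] by simp
qed

text \<open>At angle 0 the unit vectors \<open>u\<close> and \<open>A *\<^sub>v u\<close> have inner
  product 1, so their difference has norm 0.\<close>

lemma fixed_vec:
  assumes u: "u \<in> carrier_vec N" "u \<bullet> u = 1"
    and eq: "A *\<^sub>v (A *\<^sub>v u) + u = (2 * cos (angle m 0)) \<cdot>\<^sub>v (A *\<^sub>v u)"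
  shows "A *\<^sub>v u = u"
proof -
  let ?p = "A *\<^sub>v u"
  have p: "?p \<in> carrier_vec N" using u by simp
  have up: "u \<bullet> ?p = 1" using isotypic_inner[OF u eq] by (simp add: angle_def)
  have "(?p - u) \<bullet> (?p - u) = ?p \<bullet> ?p - ?p \<bullet> u - (u \<bullet> ?p - u \<bullet> u)"
    using u p by (simp add: scalar_prod_minus_distrib[of _ N] minus_scalar_prod_distrib[of _ N])
  also have "\<dots> = 0" using u p up isometry[of u u] comm_scalar_prod[of u N ?p] by simp
  finally have "(\<Sum>i\<in>{0..<N}. (?p - u) $ i * (?p - u) $ i) = 0"
    using u by (simp add: scalar_prod_def)
  then have "\<forall>i\<in>{0..<N}. (?p - u) $ i * (?p - u) $ i = 0"
    by (subst (asm) sum_nonneg_eq_0_iff) auto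
  then show ?thesis using u p A by (intro eq_vecI) auto
qed

text \<open>Gram-Schmidt applied to \<open>u\<close> and its image: the part of the image orthogonal
  to \<open>u\<close> has length equal to the sine, which is positive. The quadratic relation then
  yields the image of \<open>v\<close>.\<close>

lemma rotation_plane_of_isotypic:
  assumes u: "u \<in> carrier_vec N" "u \<bullet> u = 1"
    and eq: "A *\<^sub>v (A *\<^sub>v u) + u = (2 * cos (angle m j)) \<cdot>\<^sub>v (A *\<^sub>v u)"
    and j: "0 < j" "j \<le> m div 2"
  defines "v \<equiv> (1 / sin (angle m j)) \<cdot>\<^sub>v (A *\<^sub>v u - cos (angle m j) \<cdot>\<^sub>v u)"
  shows "rotation_plane (j, u, v)"
proof -
  let ?p = "A *\<^sub>v u"
  define c s where "c = cos (angle m j)" and "s = sin (angle m j)"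
  have s: "s > 0" using sin_angle_pos[OF odd j] by (simp add: s_def)
  have cs: "c * c + s * s = 1" by (simp add: c_def s_def flip: power2_eq_square)
  have v_def': "v = (1 / s) \<cdot>\<^sub>v (?p - c \<cdot>\<^sub>v u)" by (simp add: v_def c_def s_def)
  have p: "?p \<in> carrier_vec N" and v: "v \<in> carrier_vec N" using u by (auto simp: v_def)
  have up: "u \<bullet> ?p = c" using isotypic_inner[OF u eq] by (simp add: c_def)
  have pu: "?p \<bullet> u = c" using up u p comm_scalar_prod[of u N ?p] by simp
  have pp: "?p \<bullet> ?p = 1" using isometry[of u u] u by simp
  have "u \<bullet> v = (1 / s) * (c - c)"
    unfolding v_def' using u p up
    by (simp add: scalar_prod_minus_distrib[of _ N])
  moreover have "v \<bullet> v = (1 / s) * ((1 / s) * (1 - c * c))"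
  proof -
    define q where "q = ?p - c \<cdot>\<^sub>v u"
    have q: "q \<in> carrier_vec N" using u p by (simp add: q_def)
    have "q \<bullet> q = 1 - c * c"
      unfolding q_def using u p up pu pp
      by (simp add: scalar_prod_minus_distrib[of _ N] minus_scalar_prod_distrib[of _ N])
    then show ?thesis unfolding v_def' q_def[symmetric] using q by simp
  qed
  moreover have "1 - c * c = s * s" using cs by simp
  moreover have Au: "?p = c \<cdot>\<^sub>v u + s \<cdot>\<^sub>v v"
    using u s A by (intro eq_vecI) (auto simp: v_def' field_simps)
  moreover have "A *\<^sub>v v = (- s) \<cdot>\<^sub>v u + c \<cdot>\<^sub>v v"
  proof (intro eq_vecI)
    fix i assume "i < dim_vec ((- s) \<cdot>\<^sub>v u + c \<cdot>\<^sub>v v)"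
    then have i: "i < N" using v by simp
    have "A *\<^sub>v v = (1 / s) \<cdot>\<^sub>v (A *\<^sub>v ?p - c \<cdot>\<^sub>v ?p)"
      unfolding v_def' using u p A
      by (simp add: mult_mat_vec[OF A] mult_minus_distrib_mat_vec[OF A])
    then have "(A *\<^sub>v v) $ i = (1 / s) * ((A *\<^sub>v ?p) $ i - c * ?p $ i)"
      using i u p A by simp
    also have "(A *\<^sub>v ?p) $ i = 2 * c * ?p $ i - u $ i"
      using arg_cong[OF eq, of "\<lambda>x. x $ i"] i u p A by (simp add: c_def)
    also have "(1 / s) * (2 * c * ?p $ i - u $ i - c * ?p $ i) = (1 / s) * (c * ?p $ i - u $ i)"
      by (simp add: algebra_simps)
    also have "?p $ i = c * u $ i + s * v $ i"
      using arg_cong[OF Au, of "\<lambda>x. x $ i"] i u v by simp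
    also have "(1 / s) * (c * (c * u $ i + s * v $ i) - u $ i) = (1 / s) * (c * s * v $ i - (1 - c * c) * u $ i)"
      by (simp add: algebra_simps)
    also have "\<dots> = ((- s) \<cdot>\<^sub>v u + c \<cdot>\<^sub>v v) $ i"
      unfolding \<open>1 - c * c = s * s\<close> using s i u v by (simp add: field_simps)
    finally show "(A *\<^sub>v v) $ i = ((- s) \<cdot>\<^sub>v u + c \<cdot>\<^sub>v v) $ i" .
  qed (use u v A in auto)
  ultimately show ?thesis using u v s by (simp add: c_def s_def)
qed

fun plane_vecs :: "nat \<times> real vec \<times> real vec \<Rightarrow> real vec set" where
  "plane_vecs (j, u, v) = {u, v}"

text \<open>Both orders of the inner product are demanded, which makes the relation symmetric by its
  form.\<close>

definition orthogonal_planes :: "nat \<times> real vec \<times> real vec \<Rightarrow> nat \<times> real vec \<times> real vec \<Rightarrow> bool" where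
  "orthogonal_planes p q \<longleftrightarrow> (\<forall>x\<in>plane_vecs p. \<forall>y\<in>plane_vecs q. x \<bullet> y = 0 \<and> y \<bullet> x = 0)"

text \<open>If \<open>w\<close> is orthogonal to a plane, isometry gives two homogeneous linear
  equations for the inner products of \<open>u\<close> and \<open>v\<close> with the image of
  \<open>w\<close>. Their determinant is \<open>c * c + s * s = 1\<close>.\<close>

lemma complement_invariant_planes:
  assumes "\<And>p. p \<in> S \<Longrightarrow> rotation_plane p"
  shows "complement_invariant (\<Union> (plane_vecs ` S))"
proof -
  have "x \<bullet> (A *\<^sub>v w) = 0"
    if p: "p \<in> S" "x \<in> plane_vecs p" and w: "w \<in> carrier_vec N"
      and wU: "\<forall>x\<in>\<Union> (plane_vecs ` S). x \<bullet> w = 0" for p x w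
  proof -
    obtain j u v where p_eq: "p = (j, u, v)" by (cases p)
    define c s where "c = cos (angle m j)" and "s = sin (angle m j)"
    have cs: "c * c + s * s = 1" by (simp add: c_def s_def flip: power2_eq_square)
    have uv: "u \<in> carrier_vec N" "v \<in> carrier_vec N" and
      Au: "A *\<^sub>v u = c \<cdot>\<^sub>v u + s \<cdot>\<^sub>v v" and Av: "A *\<^sub>v v = (- s) \<cdot>\<^sub>v u + c \<cdot>\<^sub>v v"
      using assms[OF p(1)] by (auto simp: p_eq c_def s_def)
    define a b where "a = u \<bullet> (A *\<^sub>v w)" and "b = v \<bullet> (A *\<^sub>v w)"
    have "u \<bullet> w = 0" "v \<bullet> w = 0" using wU p by (auto simp: p_eq)
    then have "(A *\<^sub>v u) \<bullet> (A *\<^sub>v w) = 0" "(A *\<^sub>v v) \<bullet> (A *\<^sub>v w) = 0"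
      using isometry uv w by simp_all
    then have 1: "c * a + s * b = 0" and 2: "c * b - s * a = 0"
      unfolding Au Av a_def b_def using uv w
      by (simp_all add: add_scalar_prod_distrib[of _ N] smult_scalar_prod_distrib[of _ N])
    have "(c * c + s * s) * a = c * (c * a + s * b) - s * (c * b - s * a)"
      "(c * c + s * s) * b = s * (c * a + s * b) + c * (c * b - s * a)"
      by (simp_all add: algebra_simps)
    then have "a = 0" "b = 0" unfolding 1 2 cs by simp_all
    then show ?thesis using p by (auto simp: p_eq a_def b_def)
  qed
  moreover have "plane_vecs p \<subseteq> carrier_vec N" if "p \<in> S" for p
    using assms[OF that] by (cases p) auto
  ultimately show ?thesis unfolding complement_invariant_def by blast
qed

text \<open>The given planes contribute at most \<open>2 * card S\<close> vectors, so at least two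
  dimensions are left. The second one is used when the first isotypic vector is fixed and has to be
  paired.\<close>

lemma exists_orthogonal_plane:
  assumes S: "finite S" "2 * card S + 1 < N" "\<And>p. p \<in> S \<Longrightarrow> rotation_plane p"
  obtains p where "rotation_plane p" "fst p \<le> m div 2" "\<forall>q\<in>S. orthogonal_planes p q"
proof -
  note witness = that
  define U where "U = \<Union> (plane_vecs ` S)"
  have U: "complement_invariant U" unfolding U_def by (rule complement_invariant_planes[OF S(3)])
  have finU: "finite U" using S(1) by (auto simp: U_def)
  have "card (plane_vecs p) \<le> 2" for p
    by (cases p) (simp add: card_insert_if)
  then have "card U \<le> (\<Sum>p\<in>S. 2)"
    unfolding U_def by (intro order_trans[OF card_UN_le[OF S(1)]] sum_mono)
  then have cardU: "card U + 1 < N" using S(2) by simp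
  have UN: "U \<subseteq> carrier_vec N" using U by (simp add: complement_invariant_def)
  have orthI: "\<forall>q\<in>S. orthogonal_planes (j, u, v) q"
    if "\<forall>x\<in>U. x \<bullet> u = 0" "\<forall>x\<in>U. x \<bullet> v = 0" "u \<in> carrier_vec N" "v \<in> carrier_vec N" for j u v
  proof -
    have "u \<bullet> x = 0" "v \<bullet> x = 0" if "x \<in> U" for x
      using comm_scalar_prod[of _ N x] \<open>x \<in> U\<close> that UN
      \<open>\<forall>x\<in>U. x \<bullet> u = 0\<close> \<open>\<forall>x\<in>U. x \<bullet> v = 0\<close> \<open>u \<in> _\<close> \<open>v \<in> _\<close> by auto
    then show ?thesis using that by (auto simp: orthogonal_planes_def U_def)
  qed
  \<comment> \<open>For a nonzero index one vector suffices: \<open>v\<close> is a combination of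
    \<open>u\<close> and its image, both orthogonal to \<open>U\<close>.\<close>
  have plane: thesis
    if "j \<le> m div 2" "j > 0" and u: "u \<in> carrier_vec N" "u \<bullet> u = 1" "\<forall>x\<in>U. x \<bullet> u = 0"
      and eq: "A *\<^sub>v (A *\<^sub>v u) + u = (2 * cos (angle m j)) \<cdot>\<^sub>v (A *\<^sub>v u)" for j u
  proof -
    define v where "v = (1 / sin (angle m j)) \<cdot>\<^sub>v (A *\<^sub>v u - cos (angle m j) \<cdot>\<^sub>v u)"
    have rp: "rotation_plane (j, u, v)"
      unfolding v_def using that by (intro rotation_plane_of_isotypic) auto
    have Au: "\<forall>x\<in>U. x \<bullet> (A *\<^sub>v u) = 0" using U u by (auto simp: complement_invariant_def)
    have "x \<bullet> v = 0" if "x \<in> U" for x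
    proof -
      have "x \<in> carrier_vec N" using that UN by auto
      then show ?thesis using u Au that
        by (simp add: v_def scalar_prod_minus_distrib[of _ N])
    qed
    then show thesis
      using that(1) rp u orthI[of u v j] by (intro witness[of "(j, u, v)"]) auto
  qed
  obtain j u where ju: "j \<le> m div 2" "u \<in> carrier_vec N" "u \<bullet> u = 1" "\<forall>x\<in>U. x \<bullet> u = 0"
    "A *\<^sub>v (A *\<^sub>v u) + u = (2 * cos (angle m j)) \<cdot>\<^sub>v (A *\<^sub>v u)"
    using exists_unit_isotypic_vec[OF U finU] cardU by auto
  show thesis
  proof (cases "j = 0")
    case False
    then show ?thesis using plane[of j u] ju by blast
  next
    case True
    txt \<open>
      A fixed vector spans no plane on its own: either a second fixed vector completes it,
      or the next isotypic vector spans a plane, and \<^term>\<open>u\<close> is dropped.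
    \<close>
    then have Au: "A *\<^sub>v u = u" using fixed_vec ju by simp
    have "complement_invariant (insert u U)"
      using U ju isometry[of u] Au by (auto simp: complement_invariant_def)
    moreover have "card (insert u U) < N" using cardU finU by (simp add: card_insert_if)
    ultimately obtain l v where lv: "l \<le> m div 2" "v \<in> carrier_vec N" "v \<bullet> v = 1"
      "\<forall>x\<in>insert u U. x \<bullet> v = 0"
      "A *\<^sub>v (A *\<^sub>v v) + v = (2 * cos (angle m l)) \<cdot>\<^sub>v (A *\<^sub>v v)"
      using exists_unit_isotypic_vec[of "insert u U"] finU by auto
    show ?thesis
    proof (cases "l = 0")
      case False
      then show ?thesis using plane[of l v] lv by blast
    next
      case True
      then have Av: "A *\<^sub>v v = v" using fixed_vec lv by simp
      have "rotation_plane (0, u, v)" using ju lv Au Av by (auto simp: angle_def)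
      then show ?thesis using ju lv orthI[of u v 0] by (intro witness[of "(0, u, v)"]) auto
    qed
  qed
qed

lemma exists_plane_decomposition:
  assumes "2 * r \<le> N"
  shows "\<exists>ps. length ps = r \<and> sorted (map fst ps) \<and> sorted_wrt orthogonal_planes ps \<and>
           (\<forall>p\<in>set ps. rotation_plane p \<and> fst p \<le> m div 2)"
  using assms
proof (induction r)
  case (Suc r)
  then obtain ps where ps: "length ps = r" "sorted (map fst ps)" "sorted_wrt orthogonal_planes ps"
    "\<forall>p\<in>set ps. rotation_plane p \<and> fst p \<le> m div 2" by auto
  have "2 * r + 2 \<le> N" using Suc.prems by simp
  then have "2 * card (set ps) + 1 < N" using card_length[of ps] ps(1) by linarith
  then obtain p where p: "rotation_plane p" "fst p \<le> m div 2" "\<forall>q\<in>set ps. orthogonal_planes p q"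
    using exists_orthogonal_plane[of "set ps"] ps(4) by auto
  have "\<forall>q\<in>set ps. orthogonal_planes p q \<and> orthogonal_planes q p"
    using p(3) by (auto simp: orthogonal_planes_def)
  then show ?case
    using p ps by (intro exI[of _ "insort_key fst p ps"])
      (auto simp: sorted_insort_key set_insort_key sorted_wrt_insort_key)
qed simp

end

text \<open>The columns of \<open>P\<close> are first all \<open>u i\<close>, then all
  \<open>v i\<close>, matching the block layout of \<open>rot\<close>. Entries of the conjugated
  matrix are inner products of \<open>e a\<close> with the image of \<open>e b\<close>, read off
  from the action on each plane.\<close>

lemma exists_rot_normal_form:
  assumes A: "A \<in> carrier_mat (2 * n) (2 * n)" "transpose_mat A * A = 1\<^sub>m (2 * n)"
    "A ^\<^sub>m m = 1\<^sub>m (2 * n)" and m: "odd m"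
  obtains js P where "length js = n" "sorted js" "set js \<subseteq> {..m div 2}"
    "P \<in> carrier_mat (2 * n) (2 * n)" "transpose_mat P * P = 1\<^sub>m (2 * n)"
    "A = P * rot n (\<lambda>i. angle m (js ! i)) * transpose_mat P"
proof -
  let ?N = "2 * n"
  interpret finite_order_isometry ?N m A by unfold_locales fact+
  obtain ps where ps: "length ps = n" "sorted (map fst ps)" "sorted_wrt orthogonal_planes ps"
    and planes: "\<forall>p\<in>set ps. rotation_plane p \<and> fst p \<le> m div 2"
    using exists_plane_decomposition[of n] by auto
  define js where "js = map fst ps"
  define u v where "u i = fst (snd (ps ! i))" and "v i = snd (snd (ps ! i))" for i
  define \<theta> where "\<theta> = (\<lambda>i. angle m (js ! i))"
  have ps_nth: "ps ! i = (js ! i, u i, v i)" if "i < n" for i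
    using that ps(1) by (simp add: js_def u_def v_def)
  have plane: "rotation_plane (js ! i, u i, v i)" if "i < n" for i
    using planes ps(1) that ps_nth[OF that] nth_mem[of i ps] by metis
  have orth_planes: "orthogonal_planes (ps ! i) (ps ! j)" if "i < n" "j < n" "i \<noteq> j" for i j
  proof (cases "i < j")
    case True
    then show ?thesis using sorted_wrt_nth_less[OF ps(3)] that ps(1) by simp
  next
    case False
    then have "orthogonal_planes (ps ! j) (ps ! i)"
      using sorted_wrt_nth_less[OF ps(3), of j i] that ps(1) by simp
    then show ?thesis by (auto simp: orthogonal_planes_def)
  qed
  have uv: "u i \<in> carrier_vec ?N" "v i \<in> carrier_vec ?N" if "i < n" for i
    using plane[OF that] by auto
  have Au: "A *\<^sub>v u i = cos (\<theta> i) \<cdot>\<^sub>v u i + sin (\<theta> i) \<cdot>\<^sub>v v i"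
    and Av: "A *\<^sub>v v i = (- sin (\<theta> i)) \<cdot>\<^sub>v u i + cos (\<theta> i) \<cdot>\<^sub>v v i" if "i < n" for i
    using plane[OF that] by (auto simp: \<theta>_def)
  have dot: "u i \<bullet> u j = (if i = j then 1 else 0)" "v i \<bullet> v j = (if i = j then 1 else 0)"
    "u i \<bullet> v j = 0" "v i \<bullet> u j = 0" if ij: "i < n" "j < n" for i j
    using plane[OF ij(1)] orth_planes[OF ij] comm_scalar_prod[OF uv(2)[OF ij(1)] uv(1)[OF ij(1)]]
    by (cases "i = j"; auto simp: ps_nth ij orthogonal_planes_def)+
  define e where "e b = (if b < n then u b else v (b - n))" for b
  define P where "P = mat ?N ?N (\<lambda>(a, b). e b $ a)"
  have e: "e b \<in> carrier_vec ?N" if "b < ?N" for b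
    using that uv by (auto simp: e_def)
  have P: "P \<in> carrier_mat ?N ?N" and T: "transpose_mat P \<in> carrier_mat ?N ?N" by (simp_all add: P_def)
  have colP: "col P b = e b" if "b < ?N" for b
    using e[OF that] that by (intro eq_vecI) (auto simp: P_def)
  have PP: "transpose_mat P * P = 1\<^sub>m ?N"
  proof (rule eq_matI)
    fix a b assume ab: "a < dim_row (1\<^sub>m ?N)" "b < dim_col (1\<^sub>m ?N)"
    then have "(transpose_mat P * P) $$ (a, b) = e a \<bullet> e b" using P by (simp add: colP)
    also have "\<dots> = 1\<^sub>m ?N $$ (a, b)" using ab by (auto simp: e_def dot)
    finally show "(transpose_mat P * P) $$ (a, b) = 1\<^sub>m ?N $$ (a, b)" .
  qed (use P in auto)
  have PAP: "transpose_mat P * (A * P) = rot n \<theta>"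
  proof (rule eq_matI)
    fix a b assume "a < dim_row (rot n \<theta>)" "b < dim_col (rot n \<theta>)"
    then have ab: "a < ?N" "b < ?N" by simp_all
    have "col (A * P) b = A *\<^sub>v e b" using A P ab colP by (metis col_mult2)
    then have "(transpose_mat P * (A * P)) $$ (a, b) = e a \<bullet> (A *\<^sub>v e b)"
      using A P ab by (simp add: colP)
    also have "\<dots> = rot n \<theta> $$ (a, b)"
    proof (cases "b < n")
      case True
      then have "e a \<bullet> (A *\<^sub>v e b) = cos (\<theta> b) * (e a \<bullet> u b) + sin (\<theta> b) * (e a \<bullet> v b)"
        using e[OF ab(1)] uv[OF True]
        by (simp add: e_def[of b] Au scalar_prod_add_distrib[of _ ?N] scalar_prod_smult_distrib[of _ ?N])
      then show ?thesis using True ab by (auto simp: e_def dot rot_def mat_diag_def)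
    next
      case False
      then have b: "b - n < n" using ab by simp
      then have "e a \<bullet> (A *\<^sub>v e b) = - sin (\<theta> (b - n)) * (e a \<bullet> u (b - n)) + cos (\<theta> (b - n)) * (e a \<bullet> v (b - n))"
        using e[OF ab(1)] uv[OF b] False
        by (simp add: e_def[of b] Av scalar_prod_add_distrib[of _ ?N] scalar_prod_smult_distrib[of _ ?N] del: uminus_scalar_prod)
      then show ?thesis using False b ab by (auto simp: e_def dot rot_def mat_diag_def)
    qed
    finally show "(transpose_mat P * (A * P)) $$ (a, b) = rot n \<theta> $$ (a, b)" .
  qed (use P A in auto)
  have PT: "P * transpose_mat P = 1\<^sub>m ?N" using mat_mult_left_right_inverse[OF T P PP] .
  have "P * rot n \<theta> * transpose_mat P = (P * transpose_mat P) * A * (P * transpose_mat P)"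
    unfolding PAP[symmetric] using P T A
    by (simp add: assoc_mult_mat[of _ ?N ?N _ ?N _ ?N] mult_carrier_mat[of _ ?N ?N _ ?N])
  also have "\<dots> = A" unfolding PT using A by simp
  finally have A_eq: "A = P * rot n \<theta> * transpose_mat P" by simp
  show thesis
  proof (rule that[of js P])
    show "set js \<subseteq> {..m div 2}" using planes by (auto simp: js_def)
  qed (use ps P PP A_eq in \<open>simp_all add: js_def \<theta>_def\<close>)
qed

section \<open>Counting conjugacy classes\<close>

text \<open>Sorted lists encode multisets. Splitting by whether the least value \<open>a\<close>
  heads the list gives Pascal's rule, by induction on the length and then on the range.\<close>

lemma card_sorted_lists:
  "card {xs. length xs = n \<and> sorted xs \<and> set xs \<subseteq> {a..<a + d}} = (n + d - 1) choose n"
proof (induction n arbitrary: a d)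
  case 0
  \<comment> \<open>At \<open>d = 0\<close> truncated subtraction gives
    \<open>0 choose 0 = 1\<close>, which correctly counts the empty list.\<close>
  have "{xs. length xs = 0 \<and> sorted xs \<and> set xs \<subseteq> {a..<a + d}} = {[]}" by auto
  then show ?case by simp
next
  case (Suc n)
  note IH = Suc.IH
  let ?S = "\<lambda>n a d. {xs. length xs = n \<and> sorted xs \<and> set xs \<subseteq> {a..<a + d :: nat}}"
  have fin: "finite (?S n a d)" for n a d
    by (rule finite_subset[OF _ finite_lists_length_eq[of "{a..<a + d}" n]]) auto
  show ?case
  proof (induction d arbitrary: a)
    case 0
    have "?S (Suc n) a 0 = {}" by auto
    then have "card (?S (Suc n) a 0) = 0" by (simp only: card.empty)
    moreover have "(Suc n + 0 - 1) choose Suc n = 0" by simp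
    ultimately show ?case by (simp only:)
  next
    case (Suc d)
    have "?S (Suc n) a (Suc d) = (#) a ` ?S n a (Suc d) \<union> ?S (Suc n) (Suc a) d"
    proof (intro equalityI subsetI)
      fix xs assume xs: "xs \<in> ?S (Suc n) a (Suc d)"
      then obtain y ys where [simp]: "xs = y # ys" by (cases xs) auto
      show "xs \<in> (#) a ` ?S n a (Suc d) \<union> ?S (Suc n) (Suc a) d"
      proof (cases "y = a")
        case False
        then have "\<forall>x\<in>set xs. Suc a \<le> x" using xs by force
        then have "xs \<in> ?S (Suc n) (Suc a) d" using xs by force
        then show ?thesis by blast
      qed (use xs in auto)
    next
      fix xs assume "xs \<in> (#) a ` ?S n a (Suc d) \<union> ?S (Suc n) (Suc a) d"
      then show "xs \<in> ?S (Suc n) a (Suc d)" by force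
    qed
    moreover have "(#) a ` ?S n a (Suc d) \<inter> ?S (Suc n) (Suc a) d = {}" by force
    moreover have "finite ((#) a ` ?S n a (Suc d))" "finite (?S (Suc n) (Suc a) d)"
      by (intro finite_imageI fin)+
    ultimately have "card (?S (Suc n) a (Suc d)) = card ((#) a ` ?S n a (Suc d)) + card (?S (Suc n) (Suc a) d)"
      by (simp only: card_Un_disjoint)
    also have "card ((#) a ` ?S n a (Suc d)) = (n + d) choose n"
      using IH[of a "Suc d"] by (subst card_image) auto
    also have "card (?S (Suc n) (Suc a) d) = (n + d) choose Suc n"
      using Suc.IH[of "Suc a"] by simp
    finally show ?case by simp
  qed
qed

section \<open>Conjugacy classes and systems of representatives\<close>

lemma (in group) conj_orbit_eq_iff:
  assumes x: "x \<in> carrier G" and y: "y \<in> carrier G"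
  defines "cls \<equiv> orbit G (\<lambda>g. \<lambda>x\<in>carrier G. g \<otimes> x \<otimes> inv g)"
  shows "cls x = cls y \<longleftrightarrow> (\<exists>g\<in>carrier G. x = g \<otimes> y \<otimes> inv g)"
proof
  have "x \<in> cls x"
    unfolding cls_def orbit_def using x by (intro CollectI exI[of _ \<one>]) auto
  moreover assume "cls x = cls y"
  ultimately show "\<exists>g\<in>carrier G. x = g \<otimes> y \<otimes> inv g"
    using y by (auto simp: cls_def orbit_def)
next
  assume "\<exists>g\<in>carrier G. x = g \<otimes> y \<otimes> inv g"
  then obtain g where g: "g \<in> carrier G" "x = g \<otimes> y \<otimes> inv g" by blast
  have 1: "h \<otimes> x \<otimes> inv h = (h \<otimes> g) \<otimes> y \<otimes> inv (h \<otimes> g)" if "h \<in> carrier G" for h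
    using that g y by (simp add: m_assoc inv_mult_group)
  have 2: "h \<otimes> y \<otimes> inv h = (h \<otimes> inv g) \<otimes> x \<otimes> inv (h \<otimes> inv g)" if "h \<in> carrier G" for h
  proof -
    have "(h \<otimes> inv g) \<otimes> x \<otimes> inv (h \<otimes> inv g) = h \<otimes> (inv g \<otimes> g) \<otimes> y \<otimes> (inv g \<otimes> g) \<otimes> inv h"
      using that g(1) y unfolding g(2) by (simp only: m_assoc inv_mult_group inv_inv m_closed inv_closed)
    then show ?thesis using that g(1) y by simp
  qed
  show "cls x = cls y"
  proof (intro equalityI subsetI)
    fix z assume "z \<in> cls x"
    then obtain h where "h \<in> carrier G" "z = h \<otimes> x \<otimes> inv h"
      using x by (auto simp: cls_def orbit_def)
    then show "z \<in> cls y" unfolding cls_def orbit_def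
      using 1[of h] g y by (intro CollectI exI[of _ "h \<otimes> g"]) auto
  next
    fix z assume "z \<in> cls y"
    then obtain h where "h \<in> carrier G" "z = h \<otimes> y \<otimes> inv h"
      using y by (auto simp: cls_def orbit_def)
    then show "z \<in> cls x" unfolding cls_def orbit_def
      using 2[of h] g(1) x by (intro CollectI exI[of _ "h \<otimes> inv g"]) auto
  qed
qed

lemma (in group) pow_conj:
  assumes "g \<in> carrier G" "x \<in> carrier G"
  shows "(g \<otimes> x \<otimes> inv g) [^] (m :: nat) = g \<otimes> x [^] m \<otimes> inv g"
proof (induction m)
  case (Suc m)
  have "(g \<otimes> x [^] m \<otimes> inv g) \<otimes> (g \<otimes> x \<otimes> inv g) = g \<otimes> x [^] m \<otimes> (inv g \<otimes> g) \<otimes> x \<otimes> inv g"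
    using assms by (simp only: m_assoc m_closed inv_closed nat_pow_closed)
  also have "\<dots> = g \<otimes> x [^] Suc m \<otimes> inv g"
    using assms by (simp add: m_assoc)
  finally show ?case using Suc by simp
qed (use assms in simp)

text \<open>Powers commute with conjugation, so a class lies in \<open>X\<close> as soon as one
  member does. The classes counted are those of members of \<open>X\<close>, and \<open>f\<close>
  picks exactly one representative of each.\<close>

lemma num_conj_classes_eq_card:
  assumes "group G"
    and closed: "\<And>t. t \<in> T \<Longrightarrow> f t \<in> carrier G \<and> f t [^]\<^bsub>G\<^esub> m = \<one>\<^bsub>G\<^esub>"
    and cover: "\<And>x. x \<in> carrier G \<Longrightarrow> x [^]\<^bsub>G\<^esub> m = \<one>\<^bsub>G\<^esub> \<Longrightarrow>
           \<exists>t\<in>T. \<exists>g\<in>carrier G. x = g \<otimes>\<^bsub>G\<^esub> f t \<otimes>\<^bsub>G\<^esub> inv\<^bsub>G\<^esub> g"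
    and inj: "\<And>s t g. s \<in> T \<Longrightarrow> t \<in> T \<Longrightarrow> g \<in> carrier G \<Longrightarrow>
           f s = g \<otimes>\<^bsub>G\<^esub> f t \<otimes>\<^bsub>G\<^esub> inv\<^bsub>G\<^esub> g \<Longrightarrow> s = t"
  shows "num_conj_classes G m = card T"
proof -
  interpret group G by fact
  define cls where "cls = orbit G (\<lambda>g. \<lambda>x\<in>carrier G. g \<otimes>\<^bsub>G\<^esub> x \<otimes>\<^bsub>G\<^esub> inv\<^bsub>G\<^esub> g)"
  define X where "X = {x \<in> carrier G. x [^]\<^bsub>G\<^esub> m = \<one>\<^bsub>G\<^esub>}"
  have cls_eq: "cls x = cls y \<longleftrightarrow> (\<exists>g\<in>carrier G. x = g \<otimes>\<^bsub>G\<^esub> y \<otimes>\<^bsub>G\<^esub> inv\<^bsub>G\<^esub> g)"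
    if "x \<in> carrier G" "y \<in> carrier G" for x y
    unfolding cls_def by (rule conj_orbit_eq_iff[OF that])
  have cls: "cls x = {g \<otimes>\<^bsub>G\<^esub> x \<otimes>\<^bsub>G\<^esub> inv\<^bsub>G\<^esub> g | g. g \<in> carrier G}" if "x \<in> carrier G" for x
    using that by (auto simp: cls_def orbit_def)
  have sub: "cls x \<subseteq> X" if "x \<in> X" for x
    using that by (auto simp: cls X_def pow_conj)
  have self: "x \<in> cls x" if "x \<in> carrier G" for x
    using that by (auto simp: cls intro!: exI[of _ "\<one>\<^bsub>G\<^esub>"])
  have "{C \<in> conj_classes G. C \<subseteq> X} = cls ` X"
    using sub self by (fastforce simp: conj_classes_def orbits_def X_def simp flip: cls_def)
  also have "\<dots> = (\<lambda>t. cls (f t)) ` T"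
  proof (intro equalityI subsetI)
    fix C assume "C \<in> cls ` X"
    then obtain x where x: "x \<in> carrier G" "x [^]\<^bsub>G\<^esub> m = \<one>\<^bsub>G\<^esub>" "C = cls x" by (auto simp: X_def)
    then obtain t where "t \<in> T" "\<exists>g\<in>carrier G. x = g \<otimes>\<^bsub>G\<^esub> f t \<otimes>\<^bsub>G\<^esub> inv\<^bsub>G\<^esub> g" using cover by blast
    then show "C \<in> (\<lambda>t. cls (f t)) ` T" using x cls_eq[of x "f t"] closed by blast
  qed (use closed in \<open>auto simp: X_def\<close>)
  also have "card \<dots> = card T"
    by (rule card_image) (use cls_eq closed inj in \<open>auto intro!: inj_onI\<close>)
  finally show ?thesis unfolding num_conj_classes_def X_def .
qed

section \<open>Group operations of \<open>SO\<close> as matrix operations\<close>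

lemma carrier_SO: "A \<in> carrier (SO N) \<longleftrightarrow> A \<in> carrier_mat N N \<and> transpose_mat A * A = 1\<^sub>m N \<and> det A = 1"
  by (simp add: SO_def)

lemma mult_SO [simp]: "A \<otimes>\<^bsub>SO N\<^esub> B = A * B" and one_SO [simp]: "\<one>\<^bsub>SO N\<^esub> = 1\<^sub>m N"
  by (simp_all add: SO_def)

lemma inv_SO:
  assumes "A \<in> carrier (SO N)" shows "inv\<^bsub>SO N\<^esub> A = transpose_mat A"
proof (rule group.inv_equality[OF group_SO])
  have A: "A \<in> carrier_mat N N" "transpose_mat A * A = 1\<^sub>m N" "det A = 1"
    using assms by (auto simp: carrier_SO)
  then show "transpose_mat A \<otimes>\<^bsub>SO N\<^esub> A = \<one>\<^bsub>SO N\<^esub>" by simp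
  have "A * transpose_mat A = 1\<^sub>m N" using A mat_mult_left_right_inverse[of "transpose_mat A" N A] by simp
  then show "transpose_mat A \<in> carrier (SO N)" using A by (simp add: carrier_SO det_transpose)
qed (use assms in simp)

lemma pow_SO:
  assumes "A \<in> carrier_mat N N" shows "A [^]\<^bsub>SO N\<^esub> (m :: nat) = A ^\<^sub>m m"
  using assms by (induction m) (auto simp: nat_pow_def)

section \<open>Representatives of the classes in \<open>SO (2 * n)\<close>\<close>

definition signed_angle :: "nat \<Rightarrow> nat list \<Rightarrow> bool \<Rightarrow> nat \<Rightarrow> real" where
  "signed_angle m js b i = (if b \<and> i = 0 then - angle m (js ! i) else angle m (js ! i))"

lemma signed_angle_True:
  "signed_angle m js True = (signed_angle m js False)(0 := - signed_angle m js False 0)"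
  by (auto simp: signed_angle_def)

definition normal_forms :: "nat \<Rightarrow> nat \<Rightarrow> (nat list \<times> bool) set" where
  "normal_forms n k =
     {js. length js = n \<and> sorted js \<and> set js \<subseteq> {..k}} \<times> {False} \<union>
     {js. length js = n \<and> sorted js \<and> set js \<subseteq> {1..k}} \<times> {True}"

lemma card_normal_forms:
  assumes "n > 0"
  shows "card (normal_forms n k) = ((n + k) choose n) + ((n + k - 1) choose n)"
proof -
  have fin: "finite {xs. length xs = n \<and> sorted xs \<and> set xs \<subseteq> {a..<b :: nat}}" for a b
    by (rule finite_subset[OF _ finite_lists_length_eq[of "{a..<b}" n]]) auto
  have "{..k} = {0..<0 + Suc k}" "{1..k} = {1..<1 + k}" by auto
  then show ?thesis
    unfolding normal_forms_def using fin
    by (subst card_Un_disjoint, simp_all only: card_cartesian_product card_sorted_lists) auto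
qed

text \<open>The orthogonal conjugator may have determinant -1. Composing it with the reflection
  corrects this at the price of reversing the first angle.\<close>

lemma SO_cover:
  assumes n: "n > 0" and m: "odd m"
    and A: "A \<in> carrier (SO (2 * n))" "A ^\<^sub>m m = 1\<^sub>m (2 * n)"
  shows "\<exists>(js, b)\<in>normal_forms n (m div 2). \<exists>g\<in>carrier (SO (2 * n)).
           A = g * rot n (signed_angle m js b) * transpose_mat g"
proof -
  let ?N = "2 * n"
  obtain js P where js: "length js = n" "sorted js" "set js \<subseteq> {..m div 2}" 
    and P: "P \<in> carrier_mat ?N ?N" "transpose_mat P * P = 1\<^sub>m ?N"
    and A_eq: "A = P * rot n (\<lambda>i. angle m (js ! i)) * transpose_mat P"
    using exists_rot_normal_form[of A n m] A m by (auto simp: carrier_SO)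
  define \<theta> where "\<theta> = signed_angle m js False"
  have A_eq: "A = P * rot n \<theta> * transpose_mat P" by (simp add: A_eq \<theta>_def signed_angle_def[abs_def])
  have js_False: "(js, False) \<in> normal_forms n (m div 2)"
    using js by (auto simp: normal_forms_def)
  have "det P * det P = det (transpose_mat P * P)"
    using P(1) by (simp add: det_mult[of _ ?N] det_transpose[OF P(1)])
  then have "(det P - 1) * (det P + 1) = 0" using P(2) by (simp add: algebra_simps)
  then consider "det P = 1" | "det P = - 1" by (auto simp: eq_neg_iff_add_eq_0)
  then show ?thesis
  proof cases
    case 1
    then have "P \<in> carrier (SO ?N)" using P by (simp add: carrier_SO)
    then show ?thesis using A_eq js_False unfolding \<theta>_def by blast
  next
    case 2
    let ?F = "reflection n"
    define Q where "Q = P * ?F"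
    have T: "transpose_mat P \<in> carrier_mat ?N ?N" using P by simp
    have Q: "Q \<in> carrier_mat ?N ?N" using P by (simp add: Q_def)
    have QT: "transpose_mat Q = ?F * transpose_mat P"
      unfolding Q_def using P by (subst transpose_mult[of _ ?N ?N _ ?N]) (auto simp: reflection_transpose)
    have "transpose_mat Q * Q = ?F * (transpose_mat P * P) * ?F"
      unfolding QT unfolding Q_def using P(1) T by (simp add: assoc_mult_mat[of _ ?N ?N _ ?N _ ?N] mult_carrier_mat[of _ ?N ?N _ ?N])
    also have "\<dots> = 1\<^sub>m ?N" unfolding P(2) by (simp add: reflection_square right_mult_one_mat[of _ ?N ?N])
    finally have QQ: "transpose_mat Q * Q = 1\<^sub>m ?N" .
    have detQ: "det Q = 1"
      unfolding Q_def using P 2 n by (subst det_mult[of _ ?N]) (auto simp: det_reflection)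
    have Q_SO: "Q \<in> carrier (SO ?N)" using Q QQ detQ by (simp add: carrier_SO)
    have "Q * rot n (\<theta>(0 := - \<theta> 0)) * transpose_mat Q = P * (?F * ?F) * rot n \<theta> * (?F * ?F) * transpose_mat P"
      unfolding QT unfolding Q_def reflection_rot[symmetric] using P(1) T
      by (simp add: assoc_mult_mat[of _ ?N ?N _ ?N _ ?N] mult_carrier_mat[of _ ?N ?N _ ?N] del: index_mult_mat)
    also have "\<dots> = A" unfolding reflection_square A_eq using P(1) by (simp add: right_mult_one_mat[of _ ?N ?N])
    finally have A_Q: "A = Q * rot n (\<theta>(0 := - \<theta> 0)) * transpose_mat Q" by simp
    show ?thesis
    proof (cases "0 \<in> set js")
      case True
      \<comment> \<open>Sortedness moves index 0 to the front, onto the very plane that is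
        reflected; reversing the angle 0 changes nothing.\<close>
      then have "js ! 0 = 0" using js n by (cases js) auto
      then have "\<theta>(0 := - \<theta> 0) = \<theta>" by (auto simp: \<theta>_def signed_angle_def angle_def)
      then show ?thesis using A_Q Q_SO js_False unfolding \<theta>_def by force
    next
      case False
      have "x \<in> {1..m div 2}" if "x \<in> set js" for x using that False js(3) by (auto simp: Suc_le_eq intro!: gr0I)
      then have "(js, True) \<in> normal_forms n (m div 2)"
        using js(1,2) by (simp add: normal_forms_def subset_iff)
      then show ?thesis using A_Q Q_SO unfolding \<theta>_def signed_angle_True[symmetric] by blast
    qed
  qed
qed

lemma cos_signed_angle: "cos (signed_angle m js b i) = cos (angle m (js ! i))"
  by (simp add: signed_angle_def)

text \<open>All these angles lie between 0 and pi, where the cosine is injective.\<close>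

lemma cos_angle_inj:
  assumes "odd m"
  shows "inj_on (\<lambda>j. cos (angle m j)) {..m div 2}"
proof (rule inj_onI)
  fix i j assume ij: "i \<in> {..m div 2}" "j \<in> {..m div 2}" "cos (angle m i) = cos (angle m j)"
  have m: "m > 0" using assms by (cases m) auto
  have "0 \<le> angle m i \<and> angle m i \<le> pi" if "i \<le> m div 2" for i
  proof -
    have "2 * i \<le> m" using that by linarith
    then have "2 * real i \<le> real m" by linarith
    then show ?thesis using m by (simp add: angle_def field_simps)
  qed
  then have "0 \<le> angle m i" "angle m i \<le> pi" "0 \<le> angle m j" "angle m j \<le> pi" using ij by simp_all
  then have "angle m i = angle m j" using ij(3) by (rule cos_inj_pi)
  then show "i = j" using m by (simp add: angle_def)
qed

text \<open>The multiset of cosines is invariant, injectivity of the cosine recovers the multiset of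
  indices, and a sorted list is determined by its multiset.\<close>

lemma rot_conj_list_eq:
  assumes m: "odd m"
    and js: "length js = n" "sorted js" "set js \<subseteq> {..m div 2}"
    and ls: "length ls = n" "sorted ls" "set ls \<subseteq> {..m div 2}"
    and P: "P \<in> carrier_mat (2 * n) (2 * n)" "transpose_mat P * P = 1\<^sub>m (2 * n)"
    and eq: "P * rot n (signed_angle m ls b) * transpose_mat P = rot n (signed_angle m js a)"
  shows "js = ls"
proof -
  define h where "h j = cos (angle m j)" for j
  have inj: "inj_on h {..m div 2}" using cos_angle_inj[OF m] by (simp add: h_def[abs_def])
  have map_h: "map (\<lambda>i. cos (signed_angle m xs b i)) [0..<n] = map h xs" if "length xs = n" for xs b
    using that by (intro nth_equalityI) (auto simp: cos_signed_angle h_def)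
  have "mset (map h ls) = mset (map h js)"
    using rot_conj_cos[OF P eq] by (simp only: map_h js ls)
  then have "image_mset (inv_into {..m div 2} h) (mset (map h ls)) = image_mset (inv_into {..m div 2} h) (mset (map h js))"
    by simp
  moreover have "map (inv_into {..m div 2} h) (map h xs) = xs" if "set xs \<subseteq> {..m div 2}" for xs
    using inj that by (auto intro!: map_idI inv_into_f_f)
  ultimately have "mset ls = mset js" using js ls by (metis mset_map)
  then show ?thesis using js ls by (metis properties_for_sort)
qed

text \<open>Otherwise the reflection times \<open>P\<close> would commute with the rotation and have
  determinant -1, against \<open>det_commute_rot_nonneg\<close>.\<close>

lemma no_conj_to_reflected:
  assumes P: "P \<in> carrier_mat (2 * n) (2 * n)" "det P = 1" "transpose_mat P * P = 1\<^sub>m (2 * n)"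
    and n: "n > 0" and pos: "\<And>i. i < n \<Longrightarrow> sin (\<theta> i) > 0"
  shows "P * rot n \<theta> * transpose_mat P \<noteq> rot n (\<theta>(0 := - \<theta> 0))"
proof
  let ?N = "2 * n" and ?F = "reflection n" and ?R = "rot n \<theta>"
  assume eq: "P * ?R * transpose_mat P = rot n (\<theta>(0 := - \<theta> 0))"
  have T: "transpose_mat P \<in> carrier_mat ?N ?N" using P by simp
  have FP: "?F * P \<in> carrier_mat ?N ?N" by (rule mult_carrier_mat[OF reflection_carrier P(1)])
  have "?F * P * ?R = ?F * (P * ?R * (transpose_mat P * P))"
    unfolding P(3) using P(1) by (simp add: assoc_mult_mat[of _ ?N ?N _ ?N _ ?N] mult_carrier_mat[of _ ?N ?N _ ?N] right_mult_one_mat[of _ ?N ?N])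
  also have "\<dots> = ?F * ((P * ?R * transpose_mat P) * P)"
    using P(1) T by (simp add: assoc_mult_mat[of _ ?N ?N _ ?N _ ?N] mult_carrier_mat[of _ ?N ?N _ ?N])
  also have "\<dots> = (?F * ?F) * ?R * (?F * P)"
    unfolding eq reflection_rot[symmetric] using P(1) by (simp add: assoc_mult_mat[of _ ?N ?N _ ?N _ ?N] mult_carrier_mat[of _ ?N ?N _ ?N])
  also have "\<dots> = ?R * (?F * P)" unfolding reflection_square by (simp add: left_mult_one_mat[of _ ?N ?N])
  finally have "det (?F * P) \<ge> 0" by (rule det_commute_rot_nonneg[OF FP _ pos])
  moreover have "det (?F * P) = - 1"
    using P n by (subst det_mult[of _ ?N]) (auto simp: det_reflection)
  ultimately show False by simp
qed

lemma SO_inj: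
  assumes n: "n > 0" and m: "odd m"
    and s: "(js, a) \<in> normal_forms n (m div 2)" and t: "(ls, b) \<in> normal_forms n (m div 2)"
    and P: "P \<in> carrier (SO (2 * n))"
    and eq: "rot n (signed_angle m js a) = P * rot n (signed_angle m ls b) * transpose_mat P"
  shows "(js, a) = (ls, b)"
proof -
  have P': "P \<in> carrier_mat (2 * n) (2 * n)" "det P = 1" "transpose_mat P * P = 1\<^sub>m (2 * n)"
    using P by (simp_all add: carrier_SO)
  have js: "length js = n" "sorted js" "set js \<subseteq> {..m div 2}" 
    and ls: "length ls = n" "sorted ls" "set ls \<subseteq> {..m div 2}" 
    using s t by (auto simp: normal_forms_def)
  have [simp]: "ls = js"
    using rot_conj_list_eq[OF m js ls P'(1,3) eq[symmetric]] by simp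
  have "a = b"
  proof (rule ccontr)
    assume "a \<noteq> b"
    \<comment> \<open>With different flags, one of the two forms is mirrored; hence no index is 0
      and all sines are positive.\<close>
    then have "(js, True) \<in> normal_forms n (m div 2)" using s t by (cases a; cases b) auto
    then have js_pos: "0 \<notin> set js" by (auto simp: normal_forms_def)
    have pos: "sin (angle m (js ! i)) > 0" if "i < n" for i
    proof -
      have "js ! i \<in> set js" using that js by simp
      then have "0 < js ! i" "js ! i \<le> m div 2" using js js_pos by (auto intro: gr0I)
      then show ?thesis using sin_angle_pos[OF m] by blast
    qed
    define \<theta> where "\<theta> = signed_angle m js False"
    have \<theta>: "sin (\<theta> i) > 0" if "i < n" for i using pos[OF that] by (simp add: \<theta>_def signed_angle_def)
    let ?N = "2 * n"
    show False
    proof (cases b)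
      case False
      then have "P * rot n \<theta> * transpose_mat P = rot n (\<theta>(0 := - \<theta> 0))"
        using eq \<open>a \<noteq> b\<close> by (simp add: \<theta>_def signed_angle_True)
      then show ?thesis using no_conj_to_reflected[OF P' n, of \<theta>] \<theta> by simp
    next
      case True
      \<comment> \<open>Conjugating by the inverse exchanges the two forms and reduces this case to
        the previous one.\<close>
      let ?Q = "transpose_mat P"
      have Q: "?Q \<in> carrier_mat ?N ?N" "det ?Q = 1" and PQ: "P * ?Q = 1\<^sub>m ?N"
        using P' mat_mult_left_right_inverse[of ?Q ?N P] by (auto simp: det_transpose)
      have eq': "rot n \<theta> = P * rot n (\<theta>(0 := - \<theta> 0)) * ?Q"
        using eq \<open>a \<noteq> b\<close> True by (simp add: \<theta>_def signed_angle_True)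
      have "?Q * rot n \<theta> * P = (?Q * P) * rot n (\<theta>(0 := - \<theta> 0)) * (?Q * P)"
        unfolding eq' using P'(1) Q(1) by (simp add: assoc_mult_mat[of _ ?N ?N _ ?N _ ?N] mult_carrier_mat[of _ ?N ?N _ ?N])
      also have "\<dots> = rot n (\<theta>(0 := - \<theta> 0))"
        unfolding P'(3) by (simp add: left_mult_one_mat[of _ ?N ?N] right_mult_one_mat[of _ ?N ?N])
      finally show ?thesis using no_conj_to_reflected[OF Q _ n, of \<theta>] \<theta> PQ by simp
    qed
  qed
  then show ?thesis by simp
qed

text \<open>The first summand counts multisets of size \<open>n\<close> from 0 to
  \<open>m div 2\<close>, the second those from 1 to \<open>m div 2\<close>, which contribute a
  mirrored class.\<close>

theorem num_conj_classes_SO: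
  assumes n: "n > 0" and m: "odd m"
  shows "num_conj_classes (SO (2 * n)) m = ((n + m div 2) choose n) + ((n + m div 2 - 1) choose n)"
proof -
  have "num_conj_classes (SO (2 * n)) m = card (normal_forms n (m div 2))"
  proof (rule num_conj_classes_eq_card[OF group_SO, where f = "\<lambda>(js, b). rot n (signed_angle m js b)"])
    fix t assume "t \<in> normal_forms n (m div 2)"
    obtain js b where t: "t = (js, b)" by (cases t)
    let ?R = "rot n (signed_angle m js b)"
    have m0: "m > 0" using m by (cases m) auto
    have "rot n (\<lambda>i. real m * signed_angle m js b i) = rot n (\<lambda>_. 0)"
    proof (rule rot_cong)
      fix i
      have "real m * angle m j = 2 * real j * pi" for j using m0 by (simp add: angle_def)
      then have "real m * signed_angle m js b i = 2 * real (js ! i) * pi \<or>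
         real m * signed_angle m js b i = - (2 * real (js ! i) * pi)"
        by (simp add: signed_angle_def)
      then show "cos (real m * signed_angle m js b i) = cos 0" "sin (real m * signed_angle m js b i) = sin 0"
        by (elim disjE; simp only: cos_minus sin_minus cos_2npi sin_2npi; simp)+
    qed
    then have pow: "?R ^\<^sub>m m = 1\<^sub>m (2 * n)" by (simp add: rot_pow rot_zero)
    then show "(case t of (js, b) \<Rightarrow> rot n (signed_angle m js b)) \<in> carrier (SO (2 * n)) \<and>
        (case t of (js, b) \<Rightarrow> rot n (signed_angle m js b)) [^]\<^bsub>SO (2 * n)\<^esub> m = \<one>\<^bsub>SO (2 * n)\<^esub>"
      using det_eq_1_of_odd_pow[OF _ pow m] by (simp add: t carrier_SO rot_orthogonal pow_SO)
  next
    fix A assume A: "A \<in> carrier (SO (2 * n))" "A [^]\<^bsub>SO (2 * n)\<^esub> m = \<one>\<^bsub>SO (2 * n)\<^esub>"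
    then have "A ^\<^sub>m m = 1\<^sub>m (2 * n)" by (simp add: carrier_SO pow_SO)
    then obtain js b g where t: "(js, b) \<in> normal_forms n (m div 2)" and g: "g \<in> carrier (SO (2 * n))"
      and "A = g * rot n (signed_angle m js b) * transpose_mat g"
      using SO_cover[OF n m A(1)] by blast
    then show "\<exists>t\<in>normal_forms n (m div 2). \<exists>g\<in>carrier (SO (2 * n)).
        A = g \<otimes>\<^bsub>SO (2 * n)\<^esub> (case t of (js, b) \<Rightarrow> rot n (signed_angle m js b)) \<otimes>\<^bsub>SO (2 * n)\<^esub> inv\<^bsub>SO (2 * n)\<^esub> g"
      by (intro bexI[OF _ t] bexI[OF _ g]) (simp add: inv_SO)
  next
    fix s t g
    assume "s \<in> normal_forms n (m div 2)" "t \<in> normal_forms n (m div 2)" and g: "g \<in> carrier (SO (2 * n))"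
      and "(case s of (js, b) \<Rightarrow> rot n (signed_angle m js b)) =
        g \<otimes>\<^bsub>SO (2 * n)\<^esub> (case t of (js, b) \<Rightarrow> rot n (signed_angle m js b)) \<otimes>\<^bsub>SO (2 * n)\<^esub> inv\<^bsub>SO (2 * n)\<^esub> g"
    then show "s = t"
      using SO_inj[OF n m _ _ g] by (cases s; cases t) (simp add: inv_SO)
  qed
  then show ?thesis using card_normal_forms[OF n] by simp
qed

section \<open>Evaluation of the binomial coefficients\<close>

theorem theorem12:
  fixes n m :: nat
  assumes "n > 0" and "odd m"
  shows "num_conj_classes (SO (2 * n)) m =
           binom (n + m div 2 - 1) (int (m div 2)) + 2 * binom (n + m div 2 - 1) (int (m div 2) - 1)
       \<and> real (binom (n + m div 2 - 1) (int (m div 2)) + 2 * binom (n + m div 2 - 1) (int (m div 2) - 1)) =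
           real (binom (n + m div 2 - 1) (int (m div 2))) * ((real n + real m - 1) / real n)"
proof (cases "m div 2")
  case 0
  \<comment> \<open>Here the second lower index is -1, where \<open>binom\<close> takes the value
    0.\<close>
  with assms have "m = 1" by presburger
  then show ?thesis
    using num_conj_classes_SO[OF assms] assms(1) by (simp add: binom_def)
next
  case (Suc k)
  with assms have m: "m = 2 * k + 3" by presburger
  \<comment> \<open>Now \<open>k\<close> is one less than \<open>m div 2\<close>, so both lower
    indices are natural numbers.\<close>
  let ?b = "(n + k) choose k" and ?c = "(n + k) choose Suc k"
  have binoms: "binom (n + m div 2 - 1) (int (m div 2)) = ?c" "binom (n + m div 2 - 1) (int (m div 2) - 1) = ?b"
    unfolding Suc by (simp_all add: binom_def nat_add_distrib)
  \<comment> \<open>After the symmetry of binomial coefficients this is Pascal's rule.\<close>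
  have "(n + m div 2) choose n = ?b + ?c"
    using binomial_symmetric[of "Suc k" "n + Suc k"] by (simp add: Suc)
  moreover have "(n + m div 2 - 1) choose n = ?b"
    using binomial_symmetric[of k "n + k"] by (simp add: Suc)
  ultimately have 1: "num_conj_classes (SO (2 * n)) m = ?c + 2 * ?b"
    using num_conj_classes_SO[OF assms] by simp
  \<comment> \<open>Both sides equal \<open>(n + k) * ((n + k - 1) choose k)\<close>. This ratio of
    \<open>?b\<close> to \<open>?c\<close> gives the product form.\<close>
  have "Suc k * ?c = n * ?b"
    using binomial_absorption[of k "n + k"] binomial_absorb_comp[of "n + k" k] by simp
  then have "real n * real ?b = (real k + 1) * real ?c"
    by (metis of_nat_Suc of_nat_mult add.commute)
  then have "real (?c + 2 * ?b) = real ?c * ((real n + real m - 1) / real n)"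
    using assms(1) by (simp add: m field_simps)
  with 1 show ?thesis unfolding binoms by simp
qed

end
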